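(* There exists $\widetilde f\in \widetilde{\mathrm{Diff}}_0^{\infty}(\mathbb{T}^2)$ such that: - for every neighborhood $\mathcal U$ of $\widetilde f$ in $\widetilde{\mathrm{Diff}}_0^{\infty}(\mathbb{T}^2)$ there exists $\widetilde f'\in\mathcal U$ such that $(0,0)\notin\rho(\widetilde f')$; - for every neighborhood $\mathcal U$ of $\widetilde f$ in $\widetilde{\mathrm{Diff}}_0^{0}(\mathbb{T}^2)$ there exists $\widetilde f'\in\mathcal U$ such that $(0,0)\in\mathrm{int}(\rho(\widetilde f'))$; - $\widetilde f$ has a unique fixed point, up to translation by a vector of $\mathbb{Z}^2$.
   Context: $\mathbb{T}^2=\mathbb{R}^2/\mathbb{Z}^2$ is the flat torus. For $r\in\{0,1,2,\dots,\infty\}$, $\mathrm{Diff}_0^r(\mathbb{T}^2)$ is the space of $C^r$ diffeomorphisms (homeomorphisms if $r=0$) of $\mathbb{T}^2$ homotopic to the identity, and $\widetilde{\mathrm{Diff}}_0^r(\mathbb{T}^2)$ is the space of lifts of elements of $\mathrm{Diff}_0^r(\mathbb{T}^2)$ to $\mathbb{R}^2$ (such lifts commute with integer translations), endowed with the $C^r$ topology (the uniform topology if $r=0$). The rotation set of $\widetilde f\in\widetilde{\mathrm{Diff}}_0^0(\mathbb{T}^2)$ is $$\rho(\widetilde f)=\bigcap_{i\geq 1}\overline{\bigcup_{n\geq i}\left\{\frac{\widetilde f^n(\widetilde z)-\widetilde z}{n} : \widetilde z\in\mathbb{R}^2\right\}},$$ a non empty compact convex subset of $\mathbb{R}^2$;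 $\mathrm{int}$ denotes the interior in $\mathbb{R}^2$. *)

theory Defs
  imports "HOL-Analysis.Analysis" "HOL-Library.Extended_Nat"
begin

definition Z2 :: "(real^2) set" where
  "Z2 = {m. \<forall>i. m $ i \<in> \<int>}"

text \<open>Points of the torus are the cosets of \<open>Z2\<close>; the torus carries the quotient topology.\<close>

definition torus_proj :: "real^2 \<Rightarrow> (real^2) set" where
  "torus_proj z = (\<lambda>m. z + m) ` Z2"

definition torus :: "(real^2) set topology" where
  "torus = topology (\<lambda>U. U \<subseteq> range torus_proj \<and> open (torus_proj -` U))"

lemma openin_torus:
  "openin torus U \<longleftrightarrow> U \<subseteq> range torus_proj \<and> open (torus_proj -` U)"
proof -
  have "istopology (\<lambda>U. U \<subseteq> range torus_proj \<and> open (torus_proj -` U))"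
    unfolding istopology_def by (auto simp: vimage_Union)
  then show ?thesis
    by (simp add: torus_def topology_inverse')
qed

lemma topspace_torus: "topspace torus = range torus_proj"
proof -
  have "torus_proj -` range torus_proj = UNIV"
    by auto
  then have "openin torus (range torus_proj)"
    by (simp add: openin_torus)
  then show ?thesis
    using openin_subset openin_torus openin_topspace by (metis subset_antisym)
qed

lemma quotient_map_torus_proj: "quotient_map euclidean torus torus_proj"
proof -
  have "{x. torus_proj x \<in> U} = torus_proj -` U" for U
    by auto
  then show ?thesis
    by (auto simp: quotient_map_def openin_torus topspace_torus)
qed

definition partial_deriv :: "2 \<Rightarrow> (real^2 \<Rightarrow> real^2) \<Rightarrow> real^2 \<Rightarrow> real^2" where
  "partial_deriv i F x = frechet_derivative F (at x) (axis i 1)"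

definition iter_partial :: "2 list \<Rightarrow> (real^2 \<Rightarrow> real^2) \<Rightarrow> real^2 \<Rightarrow> real^2" where
  "iter_partial is F = foldr partial_deriv is F"

text \<open>\<open>Cr_on r S F\<close> is used for open \<open>S\<close> only. It says that \<open>F\<close> is \<open>r\<close> times continuously
  differentiable on \<open>S\<close>, where \<open>r = \<infinity>\<close> means smooth and \<open>r = 0\<close> means continuous.
  Differentiability of the iterated partials of order below \<open>r\<close> is required explicitly, since
  \<^const>\<open>frechet_derivative\<close> has no meaning elsewhere.\<close>

definition Cr_on :: "enat \<Rightarrow> (real^2) set \<Rightarrow> (real^2 \<Rightarrow> real^2) \<Rightarrow> bool" where
  "Cr_on r S F \<longleftrightarrow>
     (\<forall>is. enat (length is) < r \<longrightarrow> iter_partial is F differentiable_on S) \<and>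
     (\<forall>is. enat (length is) \<le> r \<longrightarrow> continuous_on S (iter_partial is F))"

text \<open>The charts of the torus are the local inverses of the projection, so a self-map is of class
  \<open>C\<^sup>r\<close> iff near every point it is covered by a \<open>C\<^sup>r\<close> map of the plane.\<close>

definition torus_Cr :: "enat \<Rightarrow> ((real^2) set \<Rightarrow> (real^2) set) \<Rightarrow> bool" where
  "torus_Cr r h \<longleftrightarrow>
     (\<forall>z. \<exists>S F. open S \<and> z \<in> S \<and> Cr_on r S F \<and>
        (\<forall>x\<in>S. torus_proj (F x) = h (torus_proj x)))"

definition torus_Diff0 :: "enat \<Rightarrow> ((real^2) set \<Rightarrow> (real^2) set) set" where
  "torus_Diff0 r = {h. (\<exists>k. homeomorphic_maps torus torus h k \<and> torus_Cr r h \<and> torus_Cr r k) \<and>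
     homotopic_with (\<lambda>_. True) torus torus h id}"

text \<open>Lifts are only required to be continuous: as the projection is a local diffeomorphism, a
  continuous lift of a \<open>C\<^sup>r\<close> map is automatically \<open>C\<^sup>r\<close>.\<close>

definition lift_Diff0 :: "enat \<Rightarrow> (real^2 \<Rightarrow> real^2) set" where
  "lift_Diff0 r = {F. continuous_on UNIV F \<and>
     (\<exists>h\<in>torus_Diff0 r. \<forall>z. torus_proj (F z) = h (torus_proj z))}"

text \<open>For finite \<open>k\<close>, \<open>Ck_ball r k \<epsilon> F\<close> collects the lifts all of whose partial derivatives of order
  at most \<open>k\<close> are uniformly \<open>\<epsilon>\<close>-close to those of \<open>F\<close>. The \<open>C\<^sup>r\<close> topology has these sets as
  neighbourhood bases, where \<open>k\<close> ranges over all finite orders up to \<open>r\<close>: for \<open>r = 0\<close> it is the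
  uniform topology, and for \<open>r = \<infinity>\<close> all finite orders occur.\<close>

definition Ck_ball :: "enat \<Rightarrow> nat \<Rightarrow> real \<Rightarrow> (real^2 \<Rightarrow> real^2) \<Rightarrow> (real^2 \<Rightarrow> real^2) set" where
  "Ck_ball r k \<epsilon> F = {G \<in> lift_Diff0 r.
     \<forall>is x. length is \<le> k \<longrightarrow> dist (iter_partial is G x) (iter_partial is F x) < \<epsilon>}"

definition Cr_topology :: "enat \<Rightarrow> (real^2 \<Rightarrow> real^2) topology" where
  "Cr_topology r = topology (\<lambda>U. U \<subseteq> lift_Diff0 r \<and>
     (\<forall>F\<in>U. \<exists>k \<epsilon>. enat k \<le> r \<and> \<epsilon> > 0 \<and> Ck_ball r k \<epsilon> F \<subseteq> U))"

lemma Ck_ball_mono: "k \<le> k' \<Longrightarrow> \<epsilon>' \<le> \<epsilon> \<Longrightarrow> Ck_ball r k' \<epsilon>' F \<subseteq> Ck_ball r k \<epsilon> F"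
  unfolding Ck_ball_def by (blast intro: order.trans less_le_trans)

lemma openin_Cr_topology:
  "openin (Cr_topology r) U \<longleftrightarrow> U \<subseteq> lift_Diff0 r \<and>
     (\<forall>F\<in>U. \<exists>k \<epsilon>. enat k \<le> r \<and> \<epsilon> > 0 \<and> Ck_ball r k \<epsilon> F \<subseteq> U)"
proof -
  let ?P = "\<lambda>U. U \<subseteq> lift_Diff0 r \<and>
     (\<forall>F\<in>U. \<exists>k \<epsilon>. enat k \<le> r \<and> \<epsilon> > 0 \<and> Ck_ball r k \<epsilon> F \<subseteq> U)"
  have "istopology ?P"
    unfolding istopology_def
  proof (intro conjI allI impI)
    fix S T assume S: "?P S" and T: "?P T"
    show "S \<inter> T \<subseteq> lift_Diff0 r"
      using S by blast
    show "\<forall>F\<in>S \<inter> T. \<exists>k \<epsilon>. enat k \<le> r \<and> \<epsilon> > 0 \<and> Ck_ball r k \<epsilon> F \<subseteq> S \<inter> T"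
    proof
      fix F assume "F \<in> S \<inter> T"
      then obtain k \<epsilon> k' \<epsilon>' where
        1: "enat k \<le> r" "\<epsilon> > 0" "Ck_ball r k \<epsilon> F \<subseteq> S" and
        2: "enat k' \<le> r" "\<epsilon>' > 0" "Ck_ball r k' \<epsilon>' F \<subseteq> T"
        using S T by (meson IntD1 IntD2)
      have "Ck_ball r (max k k') (min \<epsilon> \<epsilon>') F \<subseteq> S \<inter> T"
        using Ck_ball_mono[of k "max k k'" "min \<epsilon> \<epsilon>'" \<epsilon> r F]
          Ck_ball_mono[of k' "max k k'" "min \<epsilon> \<epsilon>'" \<epsilon>' r F] 1 2 by auto
      moreover have "enat (max k k') \<le> r" "min \<epsilon> \<epsilon>' > 0"
        using 1 2 by (auto simp: max_def)
      ultimately show "\<exists>k \<epsilon>. enat k \<le> r \<and> \<epsilon> > 0 \<and> Ck_ball r k \<epsilon> F \<subseteq> S \<inter> T"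
        by blast
    qed
  next
    fix \<K> assume K: "\<forall>K\<in>\<K>. ?P K"
    then show "\<Union>\<K> \<subseteq> lift_Diff0 r"
      by blast
    show "\<forall>F\<in>\<Union>\<K>. \<exists>k \<epsilon>. enat k \<le> r \<and> \<epsilon> > 0 \<and> Ck_ball r k \<epsilon> F \<subseteq> \<Union>\<K>"
      using K by (meson Union_iff Union_upper subset_trans)
  qed
  then show ?thesis
    by (simp add: Cr_topology_def topology_inverse')
qed

lemma topspace_Cr_topology: "topspace (Cr_topology r) = lift_Diff0 r"
proof -
  have "enat 0 \<le> r \<and> (1::real) > 0 \<and> Ck_ball r 0 1 F \<subseteq> lift_Diff0 r" for F
    by (auto simp: Ck_ball_def simp flip: zero_enat_def)
  then have "openin (Cr_topology r) (lift_Diff0 r)"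
    unfolding openin_Cr_topology by blast
  then show ?thesis
    using openin_subset openin_Cr_topology openin_topspace by (metis subset_antisym)
qed

definition rotation_set :: "(real^2 \<Rightarrow> real^2) \<Rightarrow> (real^2) set" where
  "rotation_set F =
     (\<Inter>i\<in>{1..}. closure (\<Union>n\<in>{i..}. {((F ^^ n) z - z) /\<^sub>R real n | z. True}))"

end

theory Submission
  imports Defs
begin

text \<open>
  Write \<open>(s, t)\<close> for the coordinates of the plane and put \<open>A = sin\<^sup>2 \<pi>(s - t)\<close>, \<open>B = sin\<^sup>2 \<pi>s\<close>,
  \<open>C = sin\<^sup>2 \<pi>t\<close>. The example is a small multiple of an explicit vector field added to the identity,
  \<open>f (s, t) = (s + h B (5 C - A), t + h C (5 B - A))\<close> with \<open>h = 1/1000\<close>. At the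
  fixed point \<open>0\<close> the displacement vanishes to fourth order, and this degeneracy leaves room for both
  perturbations.

  The displacement of \<open>f\<close> has a small Lipschitz constant, so \<open>f\<close> is bijective; it and its inverse are
  smooth. Since \<open>A \<le> 2 (B + C)\<close>, the two components of the displacement vanish together only on
  \<open>\<int>\<^sup>2\<close>.

  Pushing the fixed point off. Let \<open>f\<^sub>c\<close> be \<open>f\<close> followed by the translation by \<open>(c, c)\<close>, \<open>c > 0\<close>; all its
  derivatives agree with those of \<open>f\<close>. The lines \<open>s \<in> \<int>\<close> and \<open>t \<in> \<int>\<close> are invariant under \<open>f\<close>, so
  \<open>f\<^sub>c\<close> crosses them in one direction only and the integer parts of both coordinates never decrease.
  Inside a unit square the function \<open>cot \<pi>s + cot \<pi>t\<close> has derivative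
  \<open>\<pi> (2 A - 5 (B + C)) < 0\<close> along the vector field. It therefore does not increase under \<open>f\<close>, and the
  translation makes it decrease strictly under \<open>f\<^sub>c\<close>. Hence no orbit of \<open>f\<^sub>c\<close> stays in a closed unit
  square, by compactness every orbit leaves it within a uniform time, and \<open>s + t\<close> grows at a positive
  linear rate along every orbit. This excludes \<open>0\<close> from the rotation set (\<open>rotation_set_push\<close>).

  Opening the rotation set. The lines \<open>t = 0\<close>, \<open>s = 0\<close> and \<open>s = t\<close> are invariant under \<open>f\<close>, and the
  motion on them goes from \<open>0\<close> to \<open>(-1, 0)\<close>, to \<open>(0, -1)\<close> and to \<open>(1, 1)\<close>. All three targets are
  translates of the fixed point, so jumps of size \<open>a\<close> near \<open>\<int>\<^sup>2\<close> allow pseudo-orbits to follow these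
  connections in any order, and the three vectors have \<open>0\<close> in the interior of their convex hull
  (\<open>chains_in_all_directions\<close>). To turn pseudo-orbits into orbits, compose \<open>f\<close> with a vertical and a
  horizontal shear of amplitude \<open>a\<close> and very high frequency. The composition is uniformly close to
  \<open>f\<close>, and it stretches every curve that joins the left and right sides of a tiny square so much that
  a piece of the image joins the left and right sides of any prescribed tiny square centred close to
  the image of the centre (\<open>crosses_noisy\<close>). Iterating, every pseudo-orbit of \<open>f\<close> is realised up to
  the size of the square (\<open>noisy_shadows_chain\<close>), and the rotation set contains a ball about \<open>0\<close>
  (\<open>rotation_set_noisy\<close>).
\<close>

section \<open>Lifts of torus maps\<close>

lemma Z2_iff: "m \<in> Z2 \<longleftrightarrow> m $ 1 \<in> \<int> \<and> m $ 2 \<in> \<int>"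
  by (simp add: Z2_def forall_2)

lemma Z2_0 [simp]: "0 \<in> Z2"
  and Z2_add: "m \<in> Z2 \<Longrightarrow> n \<in> Z2 \<Longrightarrow> m + n \<in> Z2"
  and Z2_diff: "m \<in> Z2 \<Longrightarrow> n \<in> Z2 \<Longrightarrow> m - n \<in> Z2"
  by (auto simp: Z2_def)

lemma torus_proj_eq_iff: "torus_proj z = torus_proj w \<longleftrightarrow> z - w \<in> Z2"
proof
  assume eq: "torus_proj z = torus_proj w"
  have "z + 0 \<in> torus_proj z"
    unfolding torus_proj_def by (rule imageI) simp
  then have "z \<in> (\<lambda>m. w + m) ` Z2"
    by (simp add: eq) (simp add: torus_proj_def)
  then show "z - w \<in> Z2"
    by auto
next
  assume zw: "z - w \<in> Z2"
  show "torus_proj z = torus_proj w"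
  proof (intro equalityI subsetI)
    fix x assume "x \<in> torus_proj z"
    then obtain m where "m \<in> Z2" "x = z + m"
      by (auto simp: torus_proj_def)
    then have "x = w + (z - w + m)" "z - w + m \<in> Z2"
      using zw Z2_add by auto
    then show "x \<in> torus_proj w"
      unfolding torus_proj_def by blast
  next
    fix x assume "x \<in> torus_proj w"
    then obtain m where "m \<in> Z2" "x = w + m"
      by (auto simp: torus_proj_def)
    then have "x = z + (m - (z - w))" "m - (z - w) \<in> Z2"
      using zw Z2_diff by auto
    then show "x \<in> torus_proj z"
      unfolding torus_proj_def by blast
  qed
qed

definition Z2_equivariant :: "(real^2 \<Rightarrow> real^2) \<Rightarrow> bool" where
  "Z2_equivariant F \<longleftrightarrow> (\<forall>z. \<forall>m\<in>Z2. F (z + m) = F z + m)"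

text \<open>
  The map of the torus covered by \<open>F\<close>. It evaluates \<open>F\<close> at an arbitrary representative of the coset,
  which is harmless when \<open>F\<close> commutes with \<open>\<int>\<^sup>2\<close>.
\<close>
definition torus_map :: "(real^2 \<Rightarrow> real^2) \<Rightarrow> (real^2) set \<Rightarrow> (real^2) set" where
  "torus_map F T = torus_proj (F (inv torus_proj T))"

lemma torus_map_proj:
  assumes "Z2_equivariant F"
  shows "torus_map F (torus_proj z) = torus_proj (F z)"
proof -
  define w where "w = inv torus_proj (torus_proj z)"
  have "torus_proj w = torus_proj z"
    unfolding w_def by (rule f_inv_into_f) simp
  then have "w - z \<in> Z2"
    by (simp add: torus_proj_eq_iff)
  then have "F (z + (w - z)) = F z + (w - z)"
    using assms unfolding Z2_equivariant_def by blast
  then have "F w = F z + (w - z)"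
    by simp
  then show ?thesis
    using \<open>w - z \<in> Z2\<close> by (simp add: torus_map_def torus_proj_eq_iff flip: w_def)
qed

lemma continuous_map_torus_proj: "continuous_map euclidean torus torus_proj"
  using quotient_map_torus_proj quotient_imp_continuous_map by blast

lemma continuous_map_torus_map:
  assumes "Z2_equivariant F" "continuous_on UNIV F"
  shows "continuous_map torus torus (torus_map F)"
proof (rule continuous_compose_quotient_map[OF quotient_map_torus_proj])
  have "continuous_map euclidean torus (torus_proj \<circ> F)"
    using assms by (intro continuous_map_compose[OF _ continuous_map_torus_proj]) auto
  moreover have "torus_map F \<circ> torus_proj = torus_proj \<circ> F"
    using assms by (auto simp: torus_map_proj)
  ultimately show "continuous_map euclidean torus (torus_map F \<circ> torus_proj)"
    by simp
qed

text \<open>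
  The segment from \<open>F z\<close> to \<open>z\<close> depends equivariantly on \<open>z\<close>, so the straight-line homotopy descends
  to the torus. Its continuity there is checked upstairs, because the product of the projection with
  the compact interval is again a quotient map.
\<close>
lemma homotopic_torus_map_id:
  assumes eq: "Z2_equivariant F" and cont: "continuous_on UNIV F"
  shows "homotopic_with (\<lambda>_. True) torus torus (torus_map F) id"
proof -
  define G where "G t z = z + (1 - t) *\<^sub>R (F z - z)" for t :: real and z
  have Geq: "Z2_equivariant (G t)" for t
    using eq by (auto simp: Z2_equivariant_def G_def)
  let ?I = "top_of_set {0..1::real}"
  let ?h = "\<lambda>p. torus_map (G (fst p)) (snd p)"
  have quot: "quotient_map (prod_topology ?I euclidean) (prod_topology ?I torus)
      (\<lambda>(t, z). (t, torus_proj z))"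
    by (intro quotient_map_prod_right quotient_map_torus_proj)
      (auto intro: closed_imp_locally_compact simp: locally_compact_space_euclidean
        Hausdorff_space_subtopology locally_compact_space_closed_subset)
  have "continuous_map (prod_topology ?I torus) torus ?h"
  proof (rule continuous_compose_quotient_map[OF quot])
    have "continuous_on ({0..1} \<times> UNIV) (\<lambda>p. G (fst p) (snd p))"
      unfolding G_def
      by (intro continuous_intros continuous_on_compose2[OF cont]) auto
    then have "continuous_map (prod_topology ?I euclidean) euclidean (\<lambda>p. G (fst p) (snd p))"
      by (simp add: prod_topology_subtopology euclidean_product_topology[symmetric]
          flip: subtopology_UNIV)
    then have "continuous_map (prod_topology ?I euclidean) torus
        (torus_proj \<circ> (\<lambda>p. G (fst p) (snd p)))"
      by (intro continuous_map_compose[OF _ continuous_map_torus_proj])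
    moreover have "?h \<circ> (\<lambda>(t, z). (t, torus_proj z)) = torus_proj \<circ> (\<lambda>p. G (fst p) (snd p))"
      by (auto simp: torus_map_proj[OF Geq])
    ultimately show "continuous_map (prod_topology ?I euclidean) torus
        (?h \<circ> (\<lambda>(t, z). (t, torus_proj z)))"
      by simp
  qed
  moreover have "?h (0, x) = torus_map F x" "?h (1, x) = id x" if "x \<in> topspace torus" for x
  proof -
    from that obtain z where z: "x = torus_proj z"
      by (auto simp: topspace_torus)
    show "?h (0, x) = torus_map F x" "?h (1, x) = id x"
      unfolding z by (simp_all add: torus_map_proj Geq eq) (simp_all add: G_def)
  qed
  ultimately show ?thesis
    by (subst homotopic_with) auto
qed

lemma torus_Cr_torus_map:
  assumes "Z2_equivariant F" "Cr_on r UNIV F"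
  shows "torus_Cr r (torus_map F)"
  unfolding torus_Cr_def using assms
  by (intro allI exI[of _ UNIV] exI[of _ F]) (simp add: torus_map_proj)

lemma lift_Diff0I:
  assumes eq: "Z2_equivariant F" and inv: "\<And>z. G (F z) = z" "\<And>z. F (G z) = z"
    and F: "continuous_on UNIV F" "Cr_on r UNIV F"
    and G: "continuous_on UNIV G" "Cr_on r UNIV G"
  shows "F \<in> lift_Diff0 r"
proof -
  have eqG: "Z2_equivariant G"
    unfolding Z2_equivariant_def
  proof (intro allI ballI)
    fix z m assume "m \<in> Z2"
    then have "F (G z + m) = z + m"
      using eq inv by (simp add: Z2_equivariant_def)
    then show "G (z + m) = G z + m"
      using inv(1)[of "G z + m"] by simp
  qed
  have "homeomorphic_maps torus torus (torus_map F) (torus_map G)"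
    unfolding homeomorphic_maps_def
    using continuous_map_torus_map[OF eq F(1)] continuous_map_torus_map[OF eqG G(1)]
    by (auto simp: topspace_torus torus_map_proj[OF eq] torus_map_proj[OF eqG] inv)
  moreover have "torus_Cr r (torus_map F)" "torus_Cr r (torus_map G)"
    by (intro torus_Cr_torus_map eq eqG F G)+
  ultimately have "torus_map F \<in> torus_Diff0 r"
    using homotopic_torus_map_id[OF eq F(1)] unfolding torus_Diff0_def by blast
  moreover have "\<forall>z. torus_proj (F z) = torus_map F (torus_proj z)"
    by (simp add: torus_map_proj[OF eq])
  ultimately show ?thesis
    unfolding lift_Diff0_def using F(1) by blast
qed

section \<open>Smoothness of maps given by formulas\<close>

text \<open>
  The functions of \<open>G z\<close> given by formulas in \<open>sin\<close>, \<open>cos\<close> and the field operations. The class is closed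
  under partial derivatives as soon as the partial derivatives of the coordinates of \<open>G\<close> lie in it, and
  this makes all its members smooth. Two choices of \<open>G\<close> matter: the identity for an explicit
  diffeomorphism \<open>F\<close>, and \<open>F\<^bsup>-1\<^esup>\<close> for its inverse, which has no formula of its own but whose
  Jacobian is rational in the Jacobian of \<open>F\<close> at \<open>F\<^bsup>-1\<^esup> z\<close>.
\<close>
inductive elementary :: "(real^2 \<Rightarrow> real^2) \<Rightarrow> (real^2 \<Rightarrow> real) \<Rightarrow> bool" for G where
  const: "elementary G (\<lambda>_. c)"
| coord: "elementary G (\<lambda>z. G z $ i)"
| add: "elementary G u \<Longrightarrow> elementary G v \<Longrightarrow> elementary G (\<lambda>z. u z + v z)"
| mult: "elementary G u \<Longrightarrow> elementary G v \<Longrightarrow> elementary G (\<lambda>z. u z * v z)"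
| sin: "elementary G u \<Longrightarrow> elementary G (\<lambda>z. sin (u z))"
| cos: "elementary G u \<Longrightarrow> elementary G (\<lambda>z. cos (u z))"
| inverse: "elementary G u \<Longrightarrow> (\<And>z. u z \<noteq> 0) \<Longrightarrow> elementary G (\<lambda>z. inverse (u z))"

lemma elementary_diff:
  assumes "elementary G u" "elementary G v"
  shows "elementary G (\<lambda>z. u z - v z)"
  using elementary.add[OF assms(1) elementary.mult[OF elementary.const[of G "-1"] assms(2)]]
  by simp

lemma elementary_power:
  assumes "elementary G u"
  shows "elementary G (\<lambda>z. u z ^ n)"
  by (induction n) (auto intro: elementary.intros assms)

lemma elementary_if:
  "elementary G u \<Longrightarrow> elementary G v \<Longrightarrow> elementary G (\<lambda>z. if P then u z else v z)"
  by (cases P) auto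

lemmas elementary_intros = elementary.intros elementary_diff elementary_power elementary_if

definition elementary_deriv :: "(real^2 \<Rightarrow> real^2) \<Rightarrow> (real^2 \<Rightarrow> real) \<Rightarrow> bool" where
  "elementary_deriv G u \<longleftrightarrow> (\<exists>a b. elementary G a \<and> elementary G b \<and>
     (\<forall>z. (u has_derivative (\<lambda>h. a z * h $ 1 + b z * h $ 2)) (at z)))"

lemma elementary_derivI:
  assumes "\<And>z. (u has_derivative (\<lambda>h. a z * h $ 1 + b z * h $ 2)) (at z)"
    and "elementary G a" "elementary G b"
  shows "elementary_deriv G u"
  using assms unfolding elementary_deriv_def by blast

lemma elementary_imp_elementary_deriv:
  assumes G: "\<And>i. elementary_deriv G (\<lambda>z. G z $ i)" and u: "elementary G u"
  shows "elementary_deriv G u"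
  using u
proof induction
  case (const c)
  show ?case
    by (rule elementary_derivI[where a = "\<lambda>_. 0" and b = "\<lambda>_. 0"])
      (auto intro: elementary.const)
next
  case (coord i)
  show ?case by (rule G)
next
  case (add u v)
  then obtain a b a' b' where
    d: "\<And>z. (u has_derivative (\<lambda>h. a z * h $ 1 + b z * h $ 2)) (at z)"
      "\<And>z. (v has_derivative (\<lambda>h. a' z * h $ 1 + b' z * h $ 2)) (at z)"
    and e: "elementary G a" "elementary G b" "elementary G a'" "elementary G b'"
    unfolding elementary_deriv_def by blast
  show ?case
  proof (rule elementary_derivI[where a = "\<lambda>z. a z + a' z" and b = "\<lambda>z. b z + b' z"])
    show "((\<lambda>z. u z + v z) has_derivative
        (\<lambda>h. (a z + a' z) * h $ 1 + (b z + b' z) * h $ 2)) (at z)" for z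
      by (rule has_derivative_eq_rhs, rule has_derivative_add[OF d]) (auto simp: algebra_simps)
  qed (intro elementary_intros e)+
next
  case (mult u v)
  then obtain a b a' b' where
    d: "\<And>z. (u has_derivative (\<lambda>h. a z * h $ 1 + b z * h $ 2)) (at z)"
      "\<And>z. (v has_derivative (\<lambda>h. a' z * h $ 1 + b' z * h $ 2)) (at z)"
    and e: "elementary G a" "elementary G b" "elementary G a'" "elementary G b'"
    unfolding elementary_deriv_def by blast
  show ?case
  proof (rule elementary_derivI[where a = "\<lambda>z. u z * a' z + a z * v z"
        and b = "\<lambda>z. u z * b' z + b z * v z"])
    show "((\<lambda>z. u z * v z) has_derivative
        (\<lambda>h. (u z * a' z + a z * v z) * h $ 1 + (u z * b' z + b z * v z) * h $ 2)) (at z)" for z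
      by (rule has_derivative_eq_rhs, rule has_derivative_mult[OF d]) (auto simp: algebra_simps)
  qed (intro elementary_intros e mult.hyps)+
next
  case (sin u)
  then obtain a b where
    d: "\<And>z. (u has_derivative (\<lambda>h. a z * h $ 1 + b z * h $ 2)) (at z)"
    and e: "elementary G a" "elementary G b"
    unfolding elementary_deriv_def by blast
  show ?case
  proof (rule elementary_derivI[where a = "\<lambda>z. cos (u z) * a z" and b = "\<lambda>z. cos (u z) * b z"])
    show "((\<lambda>z. sin (u z)) has_derivative
        (\<lambda>h. (cos (u z) * a z) * h $ 1 + (cos (u z) * b z) * h $ 2)) (at z)" for z
      by (rule has_derivative_eq_rhs, rule has_derivative_sin[OF d]) (auto simp: algebra_simps)
  qed (intro elementary_intros e sin.hyps)+
next
  case (cos u)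
  then obtain a b where
    d: "\<And>z. (u has_derivative (\<lambda>h. a z * h $ 1 + b z * h $ 2)) (at z)"
    and e: "elementary G a" "elementary G b"
    unfolding elementary_deriv_def by blast
  show ?case
  proof (rule elementary_derivI[where a = "\<lambda>z. (- 1) * sin (u z) * a z"
        and b = "\<lambda>z. (- 1) * sin (u z) * b z"])
    show "((\<lambda>z. cos (u z)) has_derivative
        (\<lambda>h. ((- 1) * sin (u z) * a z) * h $ 1 + ((- 1) * sin (u z) * b z) * h $ 2)) (at z)" for z
      by (rule has_derivative_eq_rhs, rule has_derivative_cos[OF d]) (auto simp: algebra_simps)
  qed (intro elementary_intros e cos.hyps)+
next
  case (inverse u)
  then obtain a b where
    d: "\<And>z. (u has_derivative (\<lambda>h. a z * h $ 1 + b z * h $ 2)) (at z)"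
    and e: "elementary G a" "elementary G b"
    unfolding elementary_deriv_def by blast
  let ?c = "\<lambda>z. (- 1) * inverse (u z) ^ 2"
  show ?case
  proof (rule elementary_derivI[where a = "\<lambda>z. ?c z * a z" and b = "\<lambda>z. ?c z * b z"])
    show "((\<lambda>z. inverse (u z)) has_derivative
        (\<lambda>h. (?c z * a z) * h $ 1 + (?c z * b z) * h $ 2)) (at z)" for z
      by (rule has_derivative_eq_rhs, rule Deriv.has_derivative_inverse[OF inverse.hyps(2) d])
        (auto simp: algebra_simps power2_eq_square)
  qed (intro elementary_intros e inverse.hyps)+
qed

lemma has_derivative_vec2:
  fixes F :: "'a::real_normed_vector \<Rightarrow> real^2"
  assumes "\<And>i. ((\<lambda>z. F z $ i) has_derivative (\<lambda>h. D h $ i)) (at z)"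
  shows "(F has_derivative D) (at z)"
  using assms by (auto simp: has_derivative_componentwise_within[of F] Basis_vec_def
      cart_eq_inner_axis[symmetric])

lemma elementary_iter_partial:
  assumes G: "\<And>i. elementary_deriv G (\<lambda>z. G z $ i)" and F: "\<And>i. elementary G (\<lambda>z. F z $ i)"
  shows "elementary G (\<lambda>z. iter_partial is F z $ i)"
proof (induction "is" arbitrary: i)
  case Nil
  show ?case using F by (simp add: iter_partial_def)
next
  case (Cons j "is")
  let ?F = "iter_partial is F"
  have "\<exists>a b. elementary G a \<and> elementary G b \<and>
     (\<forall>z. ((\<lambda>z. ?F z $ i) has_derivative (\<lambda>h. a z * h $ 1 + b z * h $ 2)) (at z))" for i
    using elementary_imp_elementary_deriv[OF G Cons.IH[of i]]
    unfolding elementary_deriv_def .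
  then obtain a where "\<forall>i. \<exists>b. elementary G (a i) \<and> elementary G b \<and>
     (\<forall>z. ((\<lambda>z. ?F z $ i) has_derivative (\<lambda>h. a i z * h $ 1 + b z * h $ 2)) (at z))"
    by (rule choice[OF allI, THEN exE])
  then obtain b where ab: "\<forall>i. elementary G (a i) \<and> elementary G (b i) \<and>
     (\<forall>z. ((\<lambda>z. ?F z $ i) has_derivative (\<lambda>h. a i z * h $ 1 + b i z * h $ 2)) (at z))"
    by (rule choice[THEN exE])
  then have e: "\<And>i. elementary G (a i)" "\<And>i. elementary G (b i)"
    and d: "\<And>i z. ((\<lambda>z. ?F z $ i) has_derivative (\<lambda>h. a i z * h $ 1 + b i z * h $ 2)) (at z)"
    by auto
  have "(?F has_derivative (\<lambda>h. \<chi> i. a i z * h $ 1 + b i z * h $ 2)) (at z)" for z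
    by (rule has_derivative_vec2) (simp add: d)
  then have "frechet_derivative ?F (at z) = (\<lambda>h. \<chi> i. a i z * h $ 1 + b i z * h $ 2)" for z
    by (rule frechet_derivative_at[symmetric])
  then have "iter_partial (j # is) F z $ i = (if j = 1 then a i z else b i z)" for z
    using exhaust_2[of j] by (auto simp: iter_partial_def partial_deriv_def axis_def)
  then show ?case
    using e by (cases "j = 1") auto
qed

lemma elementary_imp_smooth:
  assumes G: "\<And>i. elementary_deriv G (\<lambda>z. G z $ i)" and F: "\<And>i. elementary G (\<lambda>z. F z $ i)"
  shows "Cr_on r UNIV F"
proof -
  have diff: "iter_partial is F differentiable at z" for "is" z
  proof -
    have "\<exists>D. ((\<lambda>z. iter_partial is F z $ i) has_derivative D) (at z)" for i
      using elementary_imp_elementary_deriv[OF G elementary_iter_partial[OF G F, of "is" i]]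
      unfolding elementary_deriv_def by blast
    then obtain D where "\<forall>i. ((\<lambda>z. iter_partial is F z $ i) has_derivative D i) (at z)"
      by (rule choice[OF allI, THEN exE])
    then have "(iter_partial is F has_derivative (\<lambda>h. \<chi> i. D i h)) (at z)"
      by (intro has_derivative_vec2) simp
    then show ?thesis
      by (rule differentiableI)
  qed
  then show ?thesis
    by (auto simp: Cr_on_def differentiable_on_def intro: differentiable_imp_continuous_on)
qed

lemma elementary_deriv_id: "elementary_deriv (\<lambda>z. z) (\<lambda>z. z $ i)"
proof (rule elementary_derivI[where a = "\<lambda>_. if i = 1 then 1 else 0"
      and b = "\<lambda>_. if i = 2 then 1 else 0"])
  show "((\<lambda>z. z $ i) has_derivative
      (\<lambda>h. (if i = 1 then 1 else 0) * h $ 1 + (if i = 2 then 1 else 0) * h $ 2)) (at z)" for z :: "real^2"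
    by (rule has_derivative_eq_rhs, rule bounded_linear_imp_has_derivative)
      (use exhaust_2[of i] in \<open>auto intro: bounded_linear_vec_nth\<close>)
qed (rule elementary.const)+

lemma elementary_compose:
  assumes "elementary (\<lambda>z. z) u"
  shows "elementary G (\<lambda>z. u (G z))"
  using assms by induction (auto intro: elementary.intros)

text \<open>
  The inverse function theorem expresses the Jacobian of \<open>G = F\<^bsup>-1\<^esup>\<close> at \<open>w\<close> by Cramer's rule through the
  Jacobian of \<open>F\<close> at \<open>G w\<close>; its entries are elementary functions of \<open>G w\<close>.
\<close>
lemma elementary_deriv_inverse:
  assumes F: "\<And>i. elementary (\<lambda>z. z) (\<lambda>z. F z $ i)"
    and D: "\<And>z i. ((\<lambda>z. F z $ i) has_derivative (\<lambda>h. a i z * h $ 1 + b i z * h $ 2)) (at z)"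
    and el: "\<And>i. elementary (\<lambda>z. z) (a i)" "\<And>i. elementary (\<lambda>z. z) (b i)"
    and det: "\<And>z. a 1 z * b 2 z - b 1 z * a 2 z \<noteq> 0"
    and G: "\<And>z. F (G z) = z" "continuous_on UNIV G"
  shows "elementary_deriv G (\<lambda>z. G z $ i)"
proof -
  define d where "d z = inverse (a 1 z * b 2 z - b 1 z * a 2 z)" for z
  have eld: "elementary (\<lambda>z. z) d"
    unfolding d_def by (intro elementary_intros el det)
  define G' :: "real^2 \<Rightarrow> real^2 \<Rightarrow> real^2" where "G' w = (\<lambda>h. \<chi> i. if i = 1
      then d (G w) * b 2 (G w) * h $ 1 + (- 1) * d (G w) * b 1 (G w) * h $ 2
      else (- 1) * d (G w) * a 2 (G w) * h $ 1 + d (G w) * a 1 (G w) * h $ 2)"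
    for w
  have der: "(G has_derivative G' w) (at w)" for w
  proof (rule has_derivative_inverse_basic[where T = UNIV and f = F
        and f' = "\<lambda>h. \<chi> i. a i (G w) * h $ 1 + b i (G w) * h $ 2"])
    show "(F has_derivative (\<lambda>h. \<chi> i. a i (G w) * h $ 1 + b i (G w) * h $ 2)) (at (G w))"
      by (rule has_derivative_vec2) (simp add: D)
    show "bounded_linear (G' w)"
      unfolding G'_def linear_conv_bounded_linear[symmetric]
      by (rule linearI) (auto simp: vec_eq_iff algebra_simps)
    have dd: "d (G w) * (a 1 (G w) * b 2 (G w) - b 1 (G w) * a 2 (G w)) = 1"
      using det[of "G w"] by (simp add: d_def)
    show "G' w \<circ> (\<lambda>h. \<chi> i. a i (G w) * h $ 1 + b i (G w) * h $ 2) = id"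
    proof
      fix h :: "real^2"
      have "d (G w) * b 2 (G w) * (a 1 (G w) * h $ 1 + b 1 (G w) * h $ 2)
          + (- 1) * d (G w) * b 1 (G w) * (a 2 (G w) * h $ 1 + b 2 (G w) * h $ 2) =
          d (G w) * (a 1 (G w) * b 2 (G w) - b 1 (G w) * a 2 (G w)) * h $ 1"
        "(- 1) * d (G w) * a 2 (G w) * (a 1 (G w) * h $ 1 + b 1 (G w) * h $ 2)
          + d (G w) * a 1 (G w) * (a 2 (G w) * h $ 1 + b 2 (G w) * h $ 2) =
          d (G w) * (a 1 (G w) * b 2 (G w) - b 1 (G w) * a 2 (G w)) * h $ 2"
        by (simp_all add: algebra_simps)
      then show "(G' w \<circ> (\<lambda>h. \<chi> i. a i (G w) * h $ 1 + b i (G w) * h $ 2)) h = id h"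
        unfolding dd by (simp add: G'_def vec_eq_iff forall_2)
    qed
    show "continuous (at w) G"
      using G(2) by (simp add: continuous_on_eq_continuous_at)
  qed (use G in auto)
  have "((\<lambda>z. G z $ i) has_derivative (\<lambda>h. G' w h $ i)) (at w)" for w
    using bounded_linear.has_derivative[OF bounded_linear_vec_nth der] .
  then have di: "((\<lambda>z. G z $ i) has_derivative (\<lambda>h.
      (if i = 1 then d (G w) * b 2 (G w) else (- 1) * d (G w) * a 2 (G w)) * h $ 1 +
      (if i = 1 then (- 1) * d (G w) * b 1 (G w) else d (G w) * a 1 (G w)) * h $ 2)) (at w)" for w
    by (rule has_derivative_eq_rhs) (auto simp: G'_def)
  show ?thesis
    by (rule elementary_derivI[OF di])
      (intro elementary_intros elementary_compose[OF eld] elementary_compose[OF el(1)]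
          elementary_compose[OF el(2)])+
qed

section \<open>The diffeomorphism and its translates\<close>

definition sinsq :: "real \<Rightarrow> real" where
  "sinsq x = (sin (pi * x))\<^sup>2"

lemma sinsq_nonneg [simp]: "0 \<le> sinsq x" and sinsq_le_1 [simp]: "sinsq x \<le> 1"
  by (simp_all add: sinsq_def power2_eq_1_iff abs_square_le_1)

lemma sinsq_eq_0_iff: "sinsq x = 0 \<longleftrightarrow> x \<in> \<int>"
  using sin_times_pi_eq_0[of x] by (simp add: sinsq_def mult.commute)

lemma sinsq_minus [simp]: "sinsq (- x) = sinsq x"
  by (simp add: sinsq_def)

lemma sinsq_add_Ints:
  assumes "m \<in> \<int>"
  shows "sinsq (x + m) = sinsq x"
proof -
  have s: "sin (pi * m) = 0"
    using assms sin_times_pi_eq_0[of m] by (simp add: mult.commute)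
  then have "(cos (pi * m))\<^sup>2 = 1"
    using sin_cos_squared_add[of "pi * m"] by simp
  with s show ?thesis
    by (simp add: sinsq_def distrib_left sin_add power_mult_distrib)
qed

lemma sinsq_diff_Ints: "m \<in> \<int> \<Longrightarrow> sinsq (x - m) = sinsq x"
  using sinsq_add_Ints[of "- m" x] by simp

lemma sinsq_diff_le: "sinsq (x - y) \<le> 2 * (sinsq x + sinsq y)"
proof -
  let ?a = "sin (pi * x)" and ?b = "cos (pi * x)" and ?c = "sin (pi * y)" and ?d = "cos (pi * y)"
  have "sinsq (x - y) = (?a * ?d - ?b * ?c)\<^sup>2"
    by (simp add: sinsq_def right_diff_distrib sin_diff)
  also have "\<dots> \<le> 2 * (?a\<^sup>2 * ?d\<^sup>2 + ?b\<^sup>2 * ?c\<^sup>2)"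
    using zero_le_power2[of "?a * ?d + ?b * ?c"] by (simp add: power2_eq_square algebra_simps)
  also have "\<dots> \<le> 2 * (?a\<^sup>2 * 1 + 1 * ?c\<^sup>2)"
    by (intro mult_left_mono add_mono mult_mono) (auto simp: abs_square_le_1)
  finally show ?thesis
    by (simp add: sinsq_def)
qed

lemma abs_5_sinsq_minus_sinsq_le: "\<bar>5 * sinsq x - sinsq y\<bar> \<le> 5"
  using sinsq_le_1[of x] sinsq_le_1[of y] sinsq_nonneg[of x] sinsq_nonneg[of y] by linarith

lemma sinsq_lipschitz: "\<bar>sinsq x - sinsq y\<bar> \<le> 4 * \<bar>x - y\<bar>"
proof -
  let ?a = "pi * x" and ?b = "pi * y"
  have "sinsq x - sinsq y = sin (?a + ?b) * sin (?a - ?b)"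
    using sin_cos_squared_add[of ?a] sin_cos_squared_add[of ?b]
    unfolding sinsq_def sin_add sin_diff by algebra
  then have "\<bar>sinsq x - sinsq y\<bar> \<le> 1 * \<bar>?a - ?b\<bar>"
    by (simp only: abs_mult) (intro mult_mono abs_sin_x_le_abs_x, auto)
  also have "\<dots> = pi * \<bar>x - y\<bar>"
    by (simp add: right_diff_distrib[symmetric] abs_mult)
  also have "\<dots> \<le> 4 * \<bar>x - y\<bar>"
    using pi_less_4 by (intro mult_right_mono) auto
  finally show ?thesis .
qed

text \<open>
  The coefficient 5 only has to exceed the 4 needed for uniqueness of the fixed point by enough to
  leave room in the comparison of cotangents below; the factor 1/1000 makes the displacement a strong
  contraction and the discrete map close to the flow of the vector field.
\<close>
definition disp :: "real \<Rightarrow> real \<Rightarrow> real" where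
  "disp s t = sinsq s * (5 * sinsq t - sinsq (s - t)) / 1000"

definition push :: "real \<Rightarrow> real^2 \<Rightarrow> real^2" where
  "push c z = vector [z $ 1 + disp (z $ 1) (z $ 2) + c, z $ 2 + disp (z $ 2) (z $ 1) + c]"

lemma push_nth [simp]:
  "push c z $ 1 = z $ 1 + disp (z $ 1) (z $ 2) + c"
  "push c z $ 2 = z $ 2 + disp (z $ 2) (z $ 1) + c"
  by (simp_all add: push_def)

lemma sinsq_diff_commute: "sinsq (x - y) = sinsq (y - x)"
  using sinsq_minus[of "x - y"] by simp

lemma disp_lipschitz: "\<bar>disp s t - disp s' t'\<bar> \<le> (\<bar>s - s'\<bar> + \<bar>t - t'\<bar>) / 32"
proof -
  let ?A = "sinsq (s - t)" and ?A' = "sinsq (s' - t')"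
  have "\<bar>sinsq s * (5 * sinsq t - ?A) - sinsq s' * (5 * sinsq t' - ?A')\<bar>
      = \<bar>(sinsq s - sinsq s') * (5 * sinsq t - ?A) + sinsq s' * (5 * (sinsq t - sinsq t') + (?A' - ?A))\<bar>"
    by (simp add: algebra_simps)
  also have "\<dots> \<le> \<bar>sinsq s - sinsq s'\<bar> * \<bar>5 * sinsq t - ?A\<bar> + sinsq s' * \<bar>5 * (sinsq t - sinsq t') + (?A' - ?A)\<bar>"
    by (rule order_trans[OF abs_triangle_ineq]) (simp add: abs_mult)
  also have "\<dots> \<le> \<bar>sinsq s - sinsq s'\<bar> * 5 + 1 * (5 * \<bar>sinsq t - sinsq t'\<bar> + \<bar>?A' - ?A\<bar>)"
    by (intro add_mono mult_mono abs_5_sinsq_minus_sinsq_le) (auto simp: abs_if)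
  also have "\<dots> \<le> (4 * \<bar>s - s'\<bar>) * 5 + 1 * (5 * (4 * \<bar>t - t'\<bar>) + 4 * \<bar>(s' - t') - (s - t)\<bar>)"
    by (intro add_mono mult_mono sinsq_lipschitz) auto
  also have "\<dots> \<le> 24 * (\<bar>s - s'\<bar> + \<bar>t - t'\<bar>)"
    by (auto simp: abs_if)
  finally show ?thesis
    unfolding disp_def by (auto simp: abs_le_iff field_simps)
qed

lemma disp_add_Ints: "m \<in> \<int> \<Longrightarrow> n \<in> \<int> \<Longrightarrow> disp (s + m) (t + n) = disp s t"
  using sinsq_add_Ints[of "m - n" "s - t"] by (simp add: disp_def sinsq_add_Ints add_diff_add)

lemma norm_vec2_le: "norm (z :: real^2) \<le> \<bar>z $ 1\<bar> + \<bar>z $ 2\<bar>"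
  using norm_le_l1_cart[of z] by (simp add: sum_2)

lemma push_equivariant: "Z2_equivariant (push c)"
  by (auto simp: Z2_equivariant_def vec_eq_iff forall_2 Z2_iff disp_add_Ints)

text \<open>
  If neither \<open>sin \<pi>s\<close> nor \<open>sin \<pi>t\<close> vanishes at a fixed point, then \<open>A = 5 B = 5 C\<close>, against
  \<open>A \<le> 2 (B + C) = 4 B\<close>. If \<open>sin \<pi>s = 0\<close>, then \<open>A = C\<close>, and the second
  equation reads \<open>C\<^sup>2 = 0\<close>; the other case is symmetric.
\<close>
lemma push_fixed_iff: "push 0 z = z \<longleftrightarrow> z \<in> Z2"
proof
  assume "push 0 z = z"
  then have "disp (z $ 1) (z $ 2) = 0" "disp (z $ 2) (z $ 1) = 0"
    by (auto simp: vec_eq_iff forall_2)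
  then have eq: "sinsq (z $ 1) * (5 * sinsq (z $ 2) - sinsq (z $ 1 - z $ 2)) = 0"
    "sinsq (z $ 2) * (5 * sinsq (z $ 1) - sinsq (z $ 1 - z $ 2)) = 0"
    using sinsq_diff_commute[of "z $ 1" "z $ 2"] by (simp_all add: disp_def)
  consider "sinsq (z $ 1) = 0" | "sinsq (z $ 2) = 0" | "5 * sinsq (z $ 2) = sinsq (z $ 1 - z $ 2)"
      "5 * sinsq (z $ 1) = sinsq (z $ 1 - z $ 2)"
    using eq by auto
  then have "sinsq (z $ 1) = 0 \<and> sinsq (z $ 2) = 0"
  proof cases
    case 1
    then have "sinsq (z $ 1 - z $ 2) = sinsq (z $ 2)"
      using sinsq_diff_Ints[of "z $ 1" "z $ 2"] sinsq_diff_commute[of "z $ 1" "z $ 2"]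
      by (simp add: sinsq_eq_0_iff)
    with 1 eq(2) show ?thesis by simp
  next
    case 2
    then have "sinsq (z $ 1 - z $ 2) = sinsq (z $ 1)"
      using sinsq_diff_Ints[of "z $ 2" "z $ 1"] by (simp add: sinsq_eq_0_iff)
    with 2 eq(1) show ?thesis by simp
  next
    case 3
    moreover have "0 \<le> sinsq (z $ 1)" "0 \<le> sinsq (z $ 2)" "sinsq (z $ 1 - z $ 2) \<le> 2 * sinsq (z $ 1) + 2 * sinsq (z $ 2)"
      using sinsq_diff_le[of "z $ 1" "z $ 2"] by simp_all
    ultimately have "sinsq (z $ 1) = 0" "sinsq (z $ 2) = 0"
      by linarith+
    then show ?thesis ..
  qed
  then show "z \<in> Z2"
    by (simp add: Z2_iff sinsq_eq_0_iff)
next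
  assume "z \<in> Z2"
  then have "sinsq (z $ 1) = 0" "sinsq (z $ 2) = 0"
    by (auto simp: Z2_iff sinsq_eq_0_iff)
  then show "push 0 z = z"
    by (simp add: vec_eq_iff forall_2 disp_def)
qed

lemma push_expansion:
  "norm (z - w) \<le> 2 * norm (push c z - push c w)"
proof -
  define d where "d = (push c z - push c w) - (z - w)"
  have "\<bar>d $ 1\<bar> \<le> (\<bar>z $ 1 - w $ 1\<bar> + \<bar>z $ 2 - w $ 2\<bar>) / 32"
    "\<bar>d $ 2\<bar> \<le> (\<bar>z $ 2 - w $ 2\<bar> + \<bar>z $ 1 - w $ 1\<bar>) / 32"
    unfolding d_def using disp_lipschitz[of "z $ 1" "z $ 2" "w $ 1" "w $ 2"]
      disp_lipschitz[of "z $ 2" "z $ 1" "w $ 2" "w $ 1"] by simp_all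
  moreover have "\<bar>z $ i - w $ i\<bar> \<le> norm (z - w)" for i
    using component_le_norm_cart[of "z - w" i] by simp
  from this[of 1] this[of 2] have "\<bar>z $ 1 - w $ 1\<bar> + \<bar>z $ 2 - w $ 2\<bar> \<le> 2 * norm (z - w)"
    by simp
  ultimately have "norm d \<le> norm (z - w) / 8"
    using norm_vec2_le[of d] by simp
  moreover have "norm (z - w) \<le> norm (push c z - push c w) + norm d"
    using norm_triangle_ineq4[of "push c z - push c w" d] by (simp add: d_def)
  ultimately show ?thesis
    using norm_ge_zero[of "push c z - push c w"] by linarith
qed

text \<open>
  Solving \<open>push c z = w\<close> means finding a fixed point of \<open>z \<mapsto> w - (push c z - z)\<close>, which is a contraction.
\<close>
lemma bij_push: "bij (push c)"
proof -
  have "\<exists>z. w = push c z" for w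
  proof -
    define T where "T z = w - (push c z - z)" for z
    have "dist (T x) (T y) \<le> (1 / 8) * dist x y" for x y
    proof -
      have "\<bar>(T x - T y) $ 1\<bar> \<le> (\<bar>y $ 1 - x $ 1\<bar> + \<bar>y $ 2 - x $ 2\<bar>) / 32"
        "\<bar>(T x - T y) $ 2\<bar> \<le> (\<bar>y $ 2 - x $ 2\<bar> + \<bar>y $ 1 - x $ 1\<bar>) / 32"
        unfolding T_def using disp_lipschitz[of "y $ 1" "y $ 2" "x $ 1" "x $ 2"]
          disp_lipschitz[of "y $ 2" "y $ 1" "x $ 2" "x $ 1"] by simp_all
      moreover have "\<bar>y $ i - x $ i\<bar> \<le> norm (x - y)" for i
        using component_le_norm_cart[of "y - x" i] by (simp add: norm_minus_commute)
      from this[of 1] this[of 2] have "\<bar>y $ 1 - x $ 1\<bar> + \<bar>y $ 2 - x $ 2\<bar> \<le> 2 * norm (x - y)"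
        by simp
      ultimately show ?thesis
        using norm_vec2_le[of "T x - T y"] by (simp add: dist_norm)
    qed
    then obtain z where "T z = z"
      using banach_fix_type[of "1 / 8" T] by auto
    then show ?thesis
      by (auto simp: T_def algebra_simps)
  qed
  moreover have "inj (push c)"
  proof (rule injI)
    fix x y assume "push c x = push c y"
    then show "x = y"
      using push_expansion[of x y c] by simp
  qed
  ultimately show ?thesis
    by (simp add: bij_def surj_def)
qed

lemma continuous_inv_push: "continuous_on UNIV (inv (push c))"
proof -
  have "dist (inv (push c) x) (inv (push c) y) \<le> 2 * dist x y" for x y
    using push_expansion[of "inv (push c) x" "inv (push c) y" c] bij_push[of c]
    by (simp add: dist_norm bij_is_surj surj_f_inv_f)
  then have "2-lipschitz_on UNIV (inv (push c))"
    by (intro lipschitz_onI) auto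
  then show ?thesis
    by (rule lipschitz_on_continuous_on)
qed

definition dsinsq :: "real \<Rightarrow> real" where
  "dsinsq x = 2 * pi * sin (pi * x) * cos (pi * x)"

lemma abs_dsinsq_le: "\<bar>dsinsq x\<bar> \<le> 8"
proof -
  have "\<bar>sin (pi * x)\<bar> * \<bar>cos (pi * x)\<bar> \<le> 1 * 1"
    by (intro mult_mono) auto
  then have "(2 * pi) * (\<bar>sin (pi * x)\<bar> * \<bar>cos (pi * x)\<bar>) \<le> 8 * 1"
    using pi_less_4 by (intro mult_mono) auto
  then show ?thesis
    by (simp add: dsinsq_def abs_mult)
qed

lemma has_derivative_sinsq [derivative_intros]:
  assumes "(u has_derivative u') (at z within X)"
  shows "((\<lambda>z. sinsq (u z)) has_derivative (\<lambda>h. dsinsq (u z) * u' h)) (at z within X)"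
  unfolding sinsq_def
  by (rule has_derivative_eq_rhs, (rule derivative_intros assms)+) (auto simp: dsinsq_def)

lemma elementary_sinsq:
  assumes "elementary G u"
  shows "elementary G (\<lambda>z. sinsq (u z))" "elementary G (\<lambda>z. dsinsq (u z))"
  unfolding sinsq_def dsinsq_def by (intro elementary_intros assms)+

definition disp_fst :: "real \<Rightarrow> real \<Rightarrow> real" where
  "disp_fst s t = (dsinsq s * (5 * sinsq t - sinsq (s - t)) - sinsq s * dsinsq (s - t)) * (1 / 1000)"

definition disp_snd :: "real \<Rightarrow> real \<Rightarrow> real" where
  "disp_snd s t = sinsq s * (5 * dsinsq t + dsinsq (s - t)) * (1 / 1000)"

lemma abs_disp_fst_le: "\<bar>disp_fst s t\<bar> \<le> 1 / 10"
proof -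
  have "\<bar>dsinsq s\<bar> * \<bar>5 * sinsq t - sinsq (s - t)\<bar> + sinsq s * \<bar>dsinsq (s - t)\<bar> \<le> 8 * 5 + 1 * 8"
    by (intro add_mono mult_mono abs_dsinsq_le abs_5_sinsq_minus_sinsq_le) auto
  moreover have "\<bar>dsinsq s * (5 * sinsq t - sinsq (s - t)) - sinsq s * dsinsq (s - t)\<bar>
      \<le> \<bar>dsinsq s\<bar> * \<bar>5 * sinsq t - sinsq (s - t)\<bar> + sinsq s * \<bar>dsinsq (s - t)\<bar>"
    by (rule order_trans[OF abs_triangle_ineq4]) (simp add: abs_mult)
  ultimately show ?thesis
    unfolding disp_fst_def by (auto simp: abs_mult)
qed

lemma abs_disp_snd_le: "\<bar>disp_snd s t\<bar> \<le> 1 / 10"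
proof -
  have "\<bar>5 * dsinsq t + dsinsq (s - t)\<bar> \<le> 48"
    using abs_dsinsq_le[of t] abs_dsinsq_le[of "s - t"] by (simp add: abs_le_iff)
  then have "sinsq s * \<bar>5 * dsinsq t + dsinsq (s - t)\<bar> \<le> 1 * 48"
    by (intro mult_mono) auto
  then show ?thesis
    unfolding disp_snd_def by (auto simp: abs_mult)
qed

lemma has_derivative_disp:
  assumes "(u has_derivative u') (at z)" "(v has_derivative v') (at z)"
  shows "((\<lambda>z. disp (u z) (v z)) has_derivative
     (\<lambda>h. disp_fst (u z) (v z) * u' h + disp_snd (u z) (v z) * v' h)) (at z)"
  unfolding disp_def divide_inverse
  by (rule has_derivative_eq_rhs, (rule derivative_intros assms)+)
    (auto simp: disp_fst_def disp_snd_def algebra_simps)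

lemma elementary_disp:
  assumes "elementary G u" "elementary G v"
  shows "elementary G (\<lambda>z. disp (u z) (v z))" "elementary G (\<lambda>z. disp_fst (u z) (v z))"
    "elementary G (\<lambda>z. disp_snd (u z) (v z))"
  unfolding disp_def disp_fst_def disp_snd_def divide_inverse
  by (intro elementary_intros elementary_sinsq assms)+

lemmas elementary_id_coord = elementary.coord[where G = "\<lambda>z. z"]

lemma elementary_push: "elementary (\<lambda>z. z) (\<lambda>z. push c z $ i)"
  using exhaust_2[of i] by (auto intro!: elementary.add elementary_disp elementary_id_coord elementary.const)

lemma continuous_push: "continuous_on UNIV (push c)"
  using elementary_imp_smooth[OF elementary_deriv_id elementary_push, of 0]
  by (auto simp: Cr_on_def iter_partial_def zero_enat_def dest: spec[of _ "[]"])

lemma elementary_deriv_inv_push: "elementary_deriv (inv (push c)) (\<lambda>z. inv (push c) z $ i)"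
proof (rule elementary_deriv_inverse[where F = "push c"
      and a = "\<lambda>i z. if i = 1 then 1 + disp_fst (z $ 1) (z $ 2) else disp_snd (z $ 2) (z $ 1)"
      and b = "\<lambda>i z. if i = 1 then disp_snd (z $ 1) (z $ 2) else 1 + disp_fst (z $ 2) (z $ 1)"])
  fix z :: "real^2" and i :: 2
  have nth: "((\<lambda>z. z $ j) has_derivative (\<lambda>h. h $ j)) (at z)" for j :: 2
    by (rule bounded_linear_imp_has_derivative[OF bounded_linear_vec_nth])
  have "((\<lambda>z. push c z $ 1) has_derivative
      (\<lambda>h. (1 + disp_fst (z $ 1) (z $ 2)) * h $ 1 + disp_snd (z $ 1) (z $ 2) * h $ 2)) (at z)"
    unfolding push_nth
    by (rule has_derivative_eq_rhs, (rule has_derivative_add has_derivative_disp nth has_derivative_const)+)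
      (auto simp: algebra_simps)
  moreover have "((\<lambda>z. push c z $ 2) has_derivative
      (\<lambda>h. disp_snd (z $ 2) (z $ 1) * h $ 1 + (1 + disp_fst (z $ 2) (z $ 1)) * h $ 2)) (at z)"
    unfolding push_nth
    by (rule has_derivative_eq_rhs, (rule has_derivative_add has_derivative_disp nth has_derivative_const)+)
      (auto simp: algebra_simps)
  ultimately show "((\<lambda>z. push c z $ i) has_derivative
      (\<lambda>h. (if i = 1 then 1 + disp_fst (z $ 1) (z $ 2) else disp_snd (z $ 2) (z $ 1)) * h $ 1 +
        (if i = 1 then disp_snd (z $ 1) (z $ 2) else 1 + disp_fst (z $ 2) (z $ 1)) * h $ 2)) (at z)"
    using exhaust_2[of i] by auto
  have "\<bar>disp_snd (z $ 1) (z $ 2) * disp_snd (z $ 2) (z $ 1)\<bar> \<le> (1 / 10) * (1 / 10)"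
    unfolding abs_mult by (intro mult_mono abs_disp_snd_le) auto
  moreover have "(9 / 10) * (9 / 10) \<le> (1 + disp_fst (z $ 1) (z $ 2)) * (1 + disp_fst (z $ 2) (z $ 1))"
    using abs_disp_fst_le[of "z $ 1" "z $ 2"] abs_disp_fst_le[of "z $ 2" "z $ 1"]
    by (intro mult_mono) (auto simp: abs_le_iff)
  ultimately have "(1 + disp_fst (z $ 1) (z $ 2)) * (1 + disp_fst (z $ 2) (z $ 1))
      - disp_snd (z $ 1) (z $ 2) * disp_snd (z $ 2) (z $ 1) > 0"
    by linarith
  then show "(if 1 = (1::2) then 1 + disp_fst (z $ 1) (z $ 2) else disp_snd (z $ 2) (z $ 1)) *
      (if 2 = (1::2) then disp_snd (z $ 1) (z $ 2) else 1 + disp_fst (z $ 2) (z $ 1)) -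
      (if 1 = (1::2) then disp_snd (z $ 1) (z $ 2) else 1 + disp_fst (z $ 2) (z $ 1)) *
      (if 2 = (1::2) then 1 + disp_fst (z $ 1) (z $ 2) else disp_snd (z $ 2) (z $ 1)) \<noteq> 0"
    by simp
next
  show "push c (inv (push c) z) = z" for z
    by (rule surj_f_inv_f[OF bij_is_surj[OF bij_push]])
  show "elementary (\<lambda>z. z) (\<lambda>z. if i = 1 then 1 + disp_fst (z $ 1) (z $ 2) else disp_snd (z $ 2) (z $ 1))"
    for i :: 2
    by (intro elementary_if elementary.add[OF elementary.const] elementary_disp elementary_id_coord)
  show "elementary (\<lambda>z. z) (\<lambda>z. if i = 1 then disp_snd (z $ 1) (z $ 2) else 1 + disp_fst (z $ 2) (z $ 1))"
    for i :: 2
    by (intro elementary_if elementary.add[OF elementary.const] elementary_disp elementary_id_coord)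
qed (rule elementary_push continuous_inv_push)+

lemma push_lift_Diff0: "push c \<in> lift_Diff0 r"
proof (rule lift_Diff0I[where G = "inv (push c)"])
  show "Cr_on r UNIV (push c)"
    using elementary_deriv_id elementary_push by (rule elementary_imp_smooth)
  show "Cr_on r UNIV (inv (push c))"
    using elementary_deriv_inv_push elementary.coord by (rule elementary_imp_smooth)
qed (simp_all add: push_equivariant continuous_push continuous_inv_push
    bij_is_inj[OF bij_push] bij_is_surj[OF bij_push] surj_f_inv_f)

section \<open>A function that does not increase in the unit square\<close>

lemma cot_diff_mvt:
  assumes "0 < a" "a < b" "b < pi"
  obtains x where "a < x" "x < b" "cot a - cot b = (b - a) / (sin x)\<^sup>2"
proof -
  have "DERIV cot x :> - inverse ((sin x)\<^sup>2)" if "a \<le> x" "x \<le> b" for x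
    using that assms sin_gt_zero[of x] by (intro DERIV_cot) auto
  from MVT2[OF assms(2) this] obtain x where
    "a < x" "x < b" "cot b - cot a = (b - a) * - inverse ((sin x)\<^sup>2)"
    by blast
  then show ?thesis
    using that[of x] by (simp add: field_simps)
qed

lemma cot_less:
  assumes "0 < a" "a < b" "b < pi"
  shows "cot b < cot a"
proof -
  obtain x where x: "a < x" "x < b" "cot a - cot b = (b - a) / (sin x)\<^sup>2"
    using cot_diff_mvt[OF assms] .
  have "sin x > 0"
    using x assms by (intro sin_gt_zero) auto
  then have "(b - a) / (sin x)\<^sup>2 > 0"
    using assms by simp
  then show ?thesis
    using x(3) by linarith
qed

lemma abs_sin_diff_le: "\<bar>sin x - sin y\<bar> \<le> \<bar>x - y\<bar>" for x y :: real
proof -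
  have "sin x - sin y = 2 * sin ((x - y) / 2) * cos ((x + y) / 2)"
    by (rule sin_diff_sin)
  then have "\<bar>sin x - sin y\<bar> = 2 * (\<bar>sin ((x - y) / 2)\<bar> * \<bar>cos ((x + y) / 2)\<bar>)"
    by (simp add: abs_mult)
  also have "\<dots> \<le> 2 * (\<bar>(x - y) / 2\<bar> * 1)"
    by (intro mult_left_mono mult_mono abs_sin_x_le_abs_x) auto
  finally show ?thesis
    by simp
qed

lemma sin_pi_gt_0: "0 < s \<Longrightarrow> s < 1 \<Longrightarrow> 0 < sin (pi * s)"
  by (intro sin_gt_zero) auto

lemma abs_disp_le_sinsq: "\<bar>disp s t\<bar> \<le> sinsq s / 200"
proof -
  have "sinsq s * \<bar>5 * sinsq t - sinsq (s - t)\<bar> \<le> sinsq s * 5"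
    by (intro mult_left_mono abs_5_sinsq_minus_sinsq_le) auto
  then show ?thesis
    by (simp add: disp_def abs_mult)
qed

lemma abs_disp_le_sin:
  assumes "0 < s" "s < 1"
  shows "\<bar>disp s t\<bar> \<le> sin (pi * s) / 200"
proof -
  have "sinsq s \<le> sin (pi * s) * 1"
    unfolding sinsq_def power2_eq_square using sin_pi_gt_0[OF assms] by (intro mult_left_mono) auto
  then show ?thesis
    using abs_disp_le_sinsq[of s t] by simp
qed

lemma sin_pi_less:
  assumes s: "0 < s" "s < 1"
  shows "sin (pi * s) < 4 - 4 * s"
proof -
  have "sin (pi * s) = sin (pi * (1 - s))"
    using sin_pi_minus[of "pi * s"] by (simp add: algebra_simps)
  also have "\<dots> \<le> pi * (1 - s)"
    using s by (intro sin_x_le_x) auto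
  also have "\<dots> < 4 * (1 - s)"
    using pi_less_4 s by (intro mult_strict_right_mono) auto
  finally show ?thesis
    by simp
qed

lemma disp_unit_interval:
  assumes "0 < s" "s < 1"
  shows "0 < s + disp s t" "s + disp s t < 1"
proof -
  have "sin (pi * s) \<le> pi * s"
    using assms by (intro sin_x_le_x) auto
  also have "\<dots> < 4 * s"
    using pi_less_4 assms by (intro mult_strict_right_mono) auto
  finally have 1: "sin (pi * s) < 4 * s" .
  have "sin (pi * s) < 4 - 4 * s"
    by (rule sin_pi_less[OF assms])
  with 1 assms abs_disp_le_sin[OF assms, of t] show "0 < s + disp s t" "s + disp s t < 1"
    by linarith+
qed

text \<open>
  Since the displacement of a coordinate is at most a small multiple of \<open>sin\<^sup>2\<close> of that coordinate, one
  step changes \<open>sin\<close> by a factor close to 1 only, even near the boundary of the square where the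
  cotangent is unbounded.
\<close>
lemma sin_between_disp:
  assumes "0 < s" "s < 1" "\<bar>x - pi * s\<bar> \<le> pi * \<bar>disp s t\<bar>"
  shows "(98 / 100) * sin (pi * s) \<le> sin x" "sin x \<le> (102 / 100) * sin (pi * s)"
proof -
  have "\<bar>sin x - sin (pi * s)\<bar> \<le> pi * \<bar>disp s t\<bar>"
    using abs_sin_diff_le[of x "pi * s"] assms(3) by linarith
  also have "\<dots> \<le> 4 * \<bar>disp s t\<bar>"
    using pi_less_4 by (intro mult_right_mono) auto
  also have "\<dots> \<le> 4 * (sin (pi * s) / 200)"
    using abs_disp_le_sin[OF assms(1,2), of t] by simp
  finally show "(98 / 100) * sin (pi * s) \<le> sin x" "sin x \<le> (102 / 100) * sin (pi * s)"
    by linarith+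
qed

text \<open>
  Suppose \<open>s\<close> moves back, that is, \<open>n = A - 5 C > 0\<close>, and put \<open>m = 5 B - A\<close>. For the flow, \<open>cot \<pi>s\<close> grows
  at rate \<open>\<pi> n\<close> and \<open>cot \<pi>t\<close> decreases at rate \<open>\<pi> m\<close>, because the factors \<open>B\<close> and \<open>C\<close> in front of the
  displacements cancel against the \<open>sin\<^sup>2\<close> in the derivative of \<open>cot\<close>. Now \<open>A \<le> 2 (B + C)\<close> gives
  \<open>n \<le> 2 m / 3\<close>, and the gap between 2/3 and 1 absorbs the errors made by the discrete step in the
  mean value theorem.
\<close>
lemma cot_sum_disp_aux:
  assumes s: "0 < s" "s < 1" and t: "0 < t" "t < 1" and neg: "disp s t < 0"
  shows "cot (pi * (s + disp s t)) + cot (pi * (t + disp t s)) \<le> cot (pi * s) + cot (pi * t)"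
proof -
  define n where "n = sinsq (s - t) - 5 * sinsq t"
  define m where "m = 5 * sinsq s - sinsq (s - t)"
  have dn: "disp s t = - (sinsq s * n / 1000)" and dm: "disp t s = sinsq t * m / 1000"
    unfolding disp_def n_def m_def using sinsq_diff_commute[of t s] by (simp_all add: field_simps)
  have Spos: "0 < sinsq s" "0 < sinsq t"
    using sin_pi_gt_0[OF s] sin_pi_gt_0[OF t] by (simp_all add: sinsq_def)
  have n: "0 < n"
    using neg Spos by (simp add: dn zero_less_mult_iff)
  have nm: "3 * n \<le> 2 * m"
    using sinsq_diff_le[of s t] Spos by (simp add: n_def m_def)
  have m: "0 < m"
    using n nm by linarith
  have "0 < disp t s"
    using Spos m by (simp add: dm)
  obtain x where x: "pi * (s + disp s t) < x" "x < pi * s"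
      "cot (pi * (s + disp s t)) - cot (pi * s) = (pi * s - pi * (s + disp s t)) / (sin x)\<^sup>2"
    using cot_diff_mvt[of "pi * (s + disp s t)" "pi * s"] neg s disp_unit_interval[OF s, of t]
    by auto
  have "\<bar>x - pi * s\<bar> \<le> pi * \<bar>disp s t\<bar>"
    using x neg by (simp add: distrib_left abs_if)
  then have "(98 / 100) * sin (pi * s) \<le> sin x"
    by (rule sin_between_disp[OF s])
  then have "((98 / 100) * sin (pi * s))\<^sup>2 \<le> (sin x)\<^sup>2"
    using sin_pi_gt_0[OF s] by (intro power_mono) auto
  then have sx: "(96 / 100) * sinsq s \<le> (sin x)\<^sup>2"
    using Spos by (simp add: sinsq_def power_mult_distrib power2_eq_square)
  have "cot (pi * (s + disp s t)) - cot (pi * s) = pi * (sinsq s * n / 1000) / (sin x)\<^sup>2"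
    unfolding x(3) by (simp add: dn algebra_simps)
  also have "\<dots> \<le> pi * (sinsq s * n / 1000) / ((96 / 100) * sinsq s)"
    using n Spos sx by (intro divide_left_mono mult_pos_pos) auto
  also have "\<dots> = (pi / 1000) * (n * (100 / 96))"
    using Spos by (simp add: field_simps)
  finally have 1: "cot (pi * (s + disp s t)) - cot (pi * s) \<le> (pi / 1000) * (n * (100 / 96))" .
  obtain y where y: "pi * t < y" "y < pi * (t + disp t s)"
      "cot (pi * t) - cot (pi * (t + disp t s)) = (pi * (t + disp t s) - pi * t) / (sin y)\<^sup>2"
    using cot_diff_mvt[of "pi * t" "pi * (t + disp t s)"] \<open>0 < disp t s\<close> t disp_unit_interval[OF t, of s]
    by auto
  have "0 < sin y"
  proof (rule sin_gt_zero)
    show "0 < y"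
      using y(1) t by (smt (verit) mult_pos_pos pi_gt_zero)
    have "pi * (t + disp t s) < pi * 1"
      using disp_unit_interval[OF t, of s] by (intro mult_strict_left_mono) auto
    then show "y < pi"
      using y(2) by linarith
  qed
  have "\<bar>y - pi * t\<bar> \<le> pi * \<bar>disp t s\<bar>"
    using y \<open>0 < disp t s\<close> by (simp add: distrib_left abs_if)
  then have "sin y \<le> (102 / 100) * sin (pi * t)"
    by (rule sin_between_disp[OF t])
  then have "(sin y)\<^sup>2 \<le> ((102 / 100) * sin (pi * t))\<^sup>2"
    using \<open>0 < sin y\<close> by (intro power_mono) auto
  then have sy: "(sin y)\<^sup>2 \<le> (105 / 100) * sinsq t"
    using Spos by (simp add: sinsq_def power_mult_distrib power2_eq_square)
  have "(pi / 1000) * (m * (100 / 105)) = pi * (sinsq t * m / 1000) / ((105 / 100) * sinsq t)"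
    using Spos by (simp add: field_simps)
  also have "\<dots> \<le> pi * (sinsq t * m / 1000) / (sin y)\<^sup>2"
    using m Spos sy \<open>0 < sin y\<close> by (intro divide_left_mono mult_pos_pos) auto
  also have "\<dots> = cot (pi * t) - cot (pi * (t + disp t s))"
    unfolding y(3) by (simp add: dm algebra_simps)
  finally have 2: "(pi / 1000) * (m * (100 / 105)) \<le> cot (pi * t) - cot (pi * (t + disp t s))" .
  have "(pi / 1000) * (n * (100 / 96)) \<le> (pi / 1000) * (m * (100 / 105))"
    using nm m by (intro mult_left_mono) auto
  with 1 2 show ?thesis
    by linarith
qed

lemma cot_sum_disp:
  assumes s: "0 < s" "s < 1" and t: "0 < t" "t < 1"
  shows "cot (pi * (s + disp s t)) + cot (pi * (t + disp t s)) \<le> cot (pi * s) + cot (pi * t)"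
proof -
  consider "disp s t < 0" | "disp t s < 0" | "disp s t \<ge> 0" "disp t s \<ge> 0"
    by linarith
  then show ?thesis
  proof cases
    case 1
    then show ?thesis by (rule cot_sum_disp_aux[OF s t])
  next
    case 2
    then show ?thesis using cot_sum_disp_aux[OF t s] by linarith
  next
    case 3
    have le: "cot (pi * (a + d)) \<le> cot (pi * a)" if "0 < a" "a + d < 1" "d \<ge> 0" for a d
      using cot_less[of "pi * a" "pi * (a + d)"] that by (cases "d = 0") auto
    show ?thesis
      using 3 s t disp_unit_interval[OF s, of t] disp_unit_interval[OF t, of s] by (intro add_mono le) auto
  qed
qed

section \<open>Translating the map removes zero from the rotation set\<close>

definition unit_square :: "(real^2) set" where
  "unit_square = {z. 0 \<le> z $ 1 \<and> z $ 1 \<le> 1 \<and> 0 \<le> z $ 2 \<and> z $ 2 \<le> 1}"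

definition open_square :: "(real^2) set" where
  "open_square = {z. 0 < z $ 1 \<and> z $ 1 < 1 \<and> 0 < z $ 2 \<and> z $ 2 < 1}"

definition cot_sum :: "real^2 \<Rightarrow> real" where
  "cot_sum z = cot (pi * z $ 1) + cot (pi * z $ 2)"

lemma compact_unit_square: "compact unit_square"
proof -
  have eq: "unit_square = cbox (vector [0, 0]) (vector [1, 1])"
    by (auto simp: unit_square_def mem_box_cart forall_2)
  show ?thesis
    unfolding eq by (rule compact_cbox)
qed

lemma isCont_cot_sum:
  assumes "z \<in> open_square"
  shows "isCont cot_sum z"
proof -
  have "sin (pi * z $ 1) \<noteq> 0" "sin (pi * z $ 2) \<noteq> 0"
    using sin_pi_gt_0[of "z $ 1"] sin_pi_gt_0[of "z $ 2"] assms by (auto simp: open_square_def)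
  then show ?thesis
    unfolding cot_sum_def
    by (intro isCont_add isCont_o2[OF _ isCont_cot] isCont_mult continuous_const isCont_vec_nth
        continuous_ident)
qed

lemma isCont_push: "isCont (push c) z"
  using continuous_push[of c] by (simp add: continuous_on_eq_continuous_at)

lemma isCont_push_funpow: "isCont (push c ^^ n) z"
  by (induction n) (auto intro: isCont_o2 isCont_push simp: o_def id_def)

lemma disp_Ints: "k \<in> \<int> \<Longrightarrow> disp k t = 0"
  by (simp add: disp_def sinsq_eq_0_iff)

text \<open>
  On the line \<open>s = k\<close> the first displacement is \<open>c > 0\<close>, and its Lipschitz constant is below 1, so the
  map sends the closed half-plane to the right of the line into its interior; likewise for \<open>t\<close>.
\<close>
lemma push_gt_Ints:
  assumes "0 < c" "k \<in> \<int>"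
  shows "k \<le> z $ 1 \<Longrightarrow> k < push c z $ 1" "k \<le> z $ 2 \<Longrightarrow> k < push c z $ 2"
  using disp_lipschitz[of "z $ 1" "z $ 2" k "z $ 2"] disp_lipschitz[of "z $ 2" "z $ 1" k "z $ 1"] assms
  by (auto simp: disp_Ints)

lemma push_funpow_ge_Ints:
  assumes "0 < c" "k \<in> \<int>"
  shows "k \<le> z $ 1 \<Longrightarrow> k \<le> (push c ^^ n) z $ 1" "k \<le> z $ 2 \<Longrightarrow> k \<le> (push c ^^ n) z $ 2"
  using push_gt_Ints[OF assms] by (induction n) (auto intro: less_imp_le simp del: push_nth)

text \<open>
  The untranslated step does not increase the sum of cotangents and stays in the open square; the
  translation by \<open>(c, c)\<close> then moves both arguments to the right, where the cotangent is smaller.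
\<close>
lemma cot_sum_push_less:
  assumes c: "0 < c" and z: "z \<in> open_square" and fz: "push c z \<in> open_square"
  shows "cot_sum (push c z) < cot_sum z"
proof -
  let ?s = "z $ 1" and ?t = "z $ 2"
  have s: "0 < ?s" "?s < 1" and t: "0 < ?t" "?t < 1"
    using z by (auto simp: open_square_def)
  have "cot (pi * (?s + disp ?s ?t + c)) < cot (pi * (?s + disp ?s ?t))"
    "cot (pi * (?t + disp ?t ?s + c)) < cot (pi * (?t + disp ?t ?s))"
    using c fz disp_unit_interval[OF s, of ?t] disp_unit_interval[OF t, of ?s]
    by (auto intro!: cot_less simp: open_square_def)
  then show ?thesis
    using cot_sum_disp[OF s t] by (simp add: cot_sum_def)
qed

text \<open>
  A limit point \<open>w\<close> of an orbit that stays in the square has its whole orbit in the square. From the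
  first step on, both orbits lie in the open square, where \<open>cot_sum\<close> is continuous and strictly
  decreasing along orbits. But then it takes the same value, the limit along the first orbit, at
  consecutive points of the second one.
\<close>
lemma orbit_leaves_unit_square:
  assumes c: "0 < c" and z: "\<And>n. (push c ^^ n) z \<in> unit_square"
  shows False
proof -
  let ?g = "push c"
  let ?x = "\<lambda>n. (?g ^^ n) z"
  have openI: "?g w \<in> open_square"
    if "w \<in> unit_square" "?g w \<in> unit_square" "?g (?g w) \<in> unit_square" for w
  proof -
    have "0 < ?g w $ 1" "0 < ?g w $ 2"
      using push_gt_Ints[OF c Ints_0, of w] that(1) by (simp_all only: unit_square_def mem_Collect_eq)
    moreover have "\<not> 1 \<le> ?g w $ 1" "\<not> 1 \<le> ?g w $ 2"
      using push_gt_Ints[OF c Ints_1, of "?g w"] that(3)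
      unfolding unit_square_def mem_Collect_eq not_le[symmetric] by blast+
    ultimately show ?thesis
      unfolding open_square_def mem_Collect_eq not_le by blast
  qed
  obtain w r where w: "w \<in> unit_square" "strict_mono (r :: nat \<Rightarrow> nat)" "(?x \<circ> r) \<longlonglongrightarrow> w"
    using compact_unit_square[unfolded compact_def, rule_format, of ?x, OF z] by blast
  have lim: "(\<lambda>k. ?x (r k + n)) \<longlonglongrightarrow> (?g ^^ n) w" for n
    using isCont_tendsto_compose[OF isCont_push_funpow[where n = n and c = c and z = w] w(3)]
    by (simp add: o_def add.commute[of _ n] funpow_add)
  have orb: "(?g ^^ n) w \<in> unit_square" for n
    using compact_imp_closed[OF compact_unit_square] z lim[of n]
    by (rule closed_sequentially)
  have xo: "?x (Suc n) \<in> open_square" for n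
    using openI[of "?x n"] z[of n] z[of "Suc n"] z[of "Suc (Suc n)"] by simp
  have wo: "(?g ^^ Suc n) w \<in> open_square" for n
    using openI[of "(?g ^^ n) w"] orb[of n] orb[of "Suc n"] orb[of "Suc (Suc n)"] by simp
  have "decseq (\<lambda>n. cot_sum (?x (Suc n)))"
    unfolding decseq_Suc_iff
    using cot_sum_push_less[OF c xo] xo[of "Suc _"] by (auto intro!: less_imp_le)
  have clim: "(\<lambda>k. cot_sum (?x (r k + Suc n))) \<longlonglongrightarrow> cot_sum ((?g ^^ Suc n) w)" for n
    using isCont_tendsto_compose[OF isCont_cot_sum[OF wo] lim] .
  \<comment> \<open>Along the first orbit the values decrease, and time \<open>r (k + 1) + 1\<close> is not before time
    \<open>r k + 2\<close>; pass to the limit in this inequality.\<close>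
  have "cot_sum ((?g ^^ Suc 0) w) \<le> cot_sum ((?g ^^ Suc 1) w)"
  proof (rule LIMSEQ_le[OF _ clim[of 1]])
    show "(\<lambda>k. cot_sum (?x (r (Suc k) + Suc 0))) \<longlonglongrightarrow> cot_sum ((?g ^^ Suc 0) w)"
      using LIMSEQ_Suc[OF clim[of 0]] .
    have "cot_sum (?x (Suc (r (Suc k)))) \<le> cot_sum (?x (Suc (Suc (r k))))" for k
    proof (rule decseqD[OF \<open>decseq (\<lambda>n. cot_sum (?x (Suc n)))\<close>])
      show "Suc (r k) \<le> r (Suc k)"
        using strict_monoD[OF w(2), of k "Suc k"] by simp
    qed
    then show "\<exists>N. \<forall>k\<ge>N. cot_sum (?x (r (Suc k) + Suc 0)) \<le> cot_sum (?x (r k + Suc 1))"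
      by simp
  qed
  moreover have "cot_sum ((?g ^^ Suc 1) w) < cot_sum ((?g ^^ Suc 0) w)"
    using cot_sum_push_less[OF c wo[of 0]] wo[of 1] by simp
  ultimately show False
    by simp
qed

text \<open>
  The points that stay in the square up to time \<open>n\<close> form a decreasing sequence of compact sets with
  empty intersection, so one of them is empty.
\<close>
lemma uniform_escape_time:
  assumes c: "0 < c"
  obtains N where "0 < N" "\<And>z. z \<in> unit_square \<Longrightarrow> \<exists>n\<le>N. (push c ^^ n) z \<notin> unit_square"
proof -
  define K where "K n = {z \<in> unit_square. \<forall>j\<le>n. (push c ^^ j) z \<in> unit_square}" for n
  have cpt: "compact (K n)" for n
  proof -
    have cont: "continuous_on UNIV (push c ^^ j)" for j
      using isCont_push_funpow by (simp add: continuous_on_eq_continuous_at)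
    have "K n = unit_square \<inter> (\<Inter>j\<in>{..n}. (push c ^^ j) -` unit_square)"
      by (auto simp: K_def)
    moreover have "closed ((push c ^^ j) -` unit_square)" for j
      using closed_vimage[OF compact_imp_closed[OF compact_unit_square] cont] .
    ultimately show ?thesis
      using compact_unit_square by (auto intro!: compact_Int_closed)
  qed
  have "\<exists>n. K n = {}"
  proof (rule ccontr)
    assume "\<nexists>n. K n = {}"
    then have "(\<Inter>n. K n) \<noteq> {}"
      by (intro compact_nest cpt) (auto simp: K_def)
    then obtain z where "\<And>n. z \<in> K n"
      by blast
    then have "\<And>n. (push c ^^ n) z \<in> unit_square"
      by (auto simp: K_def)
    then show False
      by (rule orbit_leaves_unit_square[OF c])
  qed
  then obtain n where n: "K n = {}" ..
  show ?thesis
  proof (rule that[of "Suc n"])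
    fix z assume "z \<in> unit_square"
    moreover have "z \<notin> K n"
      using n by simp
    ultimately obtain j where "j \<le> n" "(push c ^^ j) z \<notin> unit_square"
      unfolding K_def by blast
    then show "\<exists>j\<le>Suc n. (push c ^^ j) z \<notin> unit_square"
      using le_SucI by blast
  qed simp
qed

lemma Z2_equivariant_funpow:
  assumes "Z2_equivariant F" "m \<in> Z2"
  shows "(F ^^ n) (z + m) = (F ^^ n) z + m"
  using assms by (induction n) (simp_all add: Z2_equivariant_def)

definition floor_sum :: "real^2 \<Rightarrow> int" where
  "floor_sum z = \<lfloor>z $ 1\<rfloor> + \<lfloor>z $ 2\<rfloor>"

lemma floor_sum_funpow_mono:
  assumes "0 < c"
  shows "floor_sum z \<le> floor_sum ((push c ^^ n) z)"
  unfolding floor_sum_def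
proof (rule add_mono)
  show "\<lfloor>z $ 1\<rfloor> \<le> \<lfloor>(push c ^^ n) z $ 1\<rfloor>"
    unfolding le_floor_iff
    by (rule push_funpow_ge_Ints(1)[OF assms Ints_of_int of_int_floor_le])
  show "\<lfloor>z $ 2\<rfloor> \<le> \<lfloor>(push c ^^ n) z $ 2\<rfloor>"
    unfolding le_floor_iff
    by (rule push_funpow_ge_Ints(2)[OF assms Ints_of_int of_int_floor_le])
qed

text \<open>
  Translated to the unit square, a point that leaves it has passed the line \<open>s = 1\<close> or the line \<open>t = 1\<close>,
  since it cannot go below 0; the integer parts keep the gain afterwards.
\<close>
lemma floor_sum_escape:
  assumes c: "0 < c" and N: "\<And>z. z \<in> unit_square \<Longrightarrow> \<exists>n\<le>N. (push c ^^ n) z \<notin> unit_square"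
  shows "floor_sum z + 1 \<le> floor_sum ((push c ^^ N) z)"
proof -
  define m :: "real^2" where "m = (\<chi> i. of_int \<lfloor>z $ i\<rfloor>)"
  define w where "w = z - m"
  have m: "m \<in> Z2"
    by (auto simp: m_def Z2_def)
  have w: "0 \<le> w $ i" "w $ i \<le> 1" for i
    using floor_correct[of "z $ i"] by (simp_all add: w_def m_def, linarith)
  then have "w \<in> unit_square"
    unfolding unit_square_def by blast
  then obtain n where n: "n \<le> N" "(push c ^^ n) w \<notin> unit_square"
    using N by blast
  have ge: "0 \<le> (push c ^^ n) w $ 1" "0 \<le> (push c ^^ n) w $ 2"
    using push_funpow_ge_Ints[OF c Ints_0 w(1)] by blast+
  then have "1 \<le> (push c ^^ n) w $ 1 \<or> 1 \<le> (push c ^^ n) w $ 2"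
    using n(2) ge unfolding unit_square_def mem_Collect_eq by linarith
  then have "1 \<le> \<lfloor>(push c ^^ n) w $ 1\<rfloor> \<or> 1 \<le> \<lfloor>(push c ^^ n) w $ 2\<rfloor>"
    by simp
  moreover have "0 \<le> \<lfloor>(push c ^^ n) w $ 1\<rfloor>" "0 \<le> \<lfloor>(push c ^^ n) w $ 2\<rfloor>"
    using ge by simp_all
  ultimately have "1 \<le> floor_sum ((push c ^^ n) w)"
    unfolding floor_sum_def by linarith
  also have "\<dots> \<le> floor_sum ((push c ^^ (N - n)) ((push c ^^ n) w))"
    by (rule floor_sum_funpow_mono[OF c])
  also have "(push c ^^ (N - n)) ((push c ^^ n) w) = (push c ^^ N) w"
    using n(1) fun_cong[OF funpow_add[of "N - n" n "push c"], of w] by simp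
  also have "floor_sum \<dots> = floor_sum ((push c ^^ N) z) - floor_sum z"
  proof -
    have "(push c ^^ N) z = (push c ^^ N) w + m"
      using Z2_equivariant_funpow[OF push_equivariant m, where n = N and z = w] by (simp add: w_def)
    then show ?thesis
      by (simp add: floor_sum_def m_def)
  qed
  finally show ?thesis
    by simp
qed

lemma rotation_set_push:
  assumes c: "0 < c"
  shows "0 \<notin> rotation_set (push c)"
proof -
  obtain N where N: "0 < N" "\<And>z. z \<in> unit_square \<Longrightarrow> \<exists>n\<le>N. (push c ^^ n) z \<notin> unit_square"
    using uniform_escape_time[OF c] by blast
  have mult: "floor_sum z + int k \<le> floor_sum ((push c ^^ (N * k)) z)" for k z
  proof (induction k)
    case (Suc k)
    have "floor_sum ((push c ^^ (N * k)) z) + 1 \<le> floor_sum ((push c ^^ N) ((push c ^^ (N * k)) z))"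
      by (rule floor_sum_escape[OF c N(2)])
    then show ?case
      using Suc by (simp add: funpow_add)
  qed auto
  have drift: "of_int (floor_sum z) + real n / real N - 1 \<le> of_int (floor_sum ((push c ^^ n) z))" for n z
  proof -
    have "floor_sum z + int (n div N) \<le> floor_sum ((push c ^^ (N * (n div N))) z)"
      by (rule mult)
    also have "\<dots> \<le> floor_sum ((push c ^^ (n mod N)) ((push c ^^ (N * (n div N))) z))"
      by (rule floor_sum_funpow_mono[OF c])
    also have "\<dots> = floor_sum ((push c ^^ n) z)"
      using fun_cong[OF funpow_add[of "n mod N" "N * (n div N)" "push c"], of z] by simp
    finally have "of_int (floor_sum z + int (n div N)) \<le> (of_int (floor_sum ((push c ^^ n) z)) :: real)"
      by (simp only: of_int_le_iff)
    moreover have "real n / real N - 1 \<le> real (n div N)"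
    proof -
      have "N * (n div N) + n mod N \<le> N * (n div N) + N"
        using mod_less_divisor[OF N(1), of n] by (intro add_left_mono less_imp_le)
      then have "n \<le> (n div N + 1) * N"
        by (simp add: algebra_simps)
      then have "real n \<le> (real (n div N) + 1) * real N"
        by (metis of_nat_1 of_nat_add of_nat_le_iff of_nat_mult)
      then show ?thesis
        using N(1) by (simp add: pos_divide_le_eq diff_le_eq)
    qed
    ultimately show ?thesis
      by simp
  qed
  define H where "H = {w :: real^2. 1 / (2 * real N) \<le> w $ 1 + w $ 2}"
  have "closed H"
    unfolding H_def by (intro closed_Collect_le continuous_intros)
  \<comment> \<open>Rounding and incomplete periods cost at most 3, which is at most half of \<open>n / N\<close> once \<open>n \<ge> 6 N\<close>.\<close>
  have "((push c ^^ n) z - z) /\<^sub>R real n \<in> H" if n: "6 * N \<le> n" for n z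
  proof -
    let ?w = "(push c ^^ n) z"
    have "real n / real N - 3 \<le> (?w $ 1 + ?w $ 2) - (z $ 1 + z $ 2)"
      using drift[of z n, unfolded floor_sum_def of_int_add]
        real_of_int_floor_add_one_gt[of "z $ 1"] real_of_int_floor_add_one_gt[of "z $ 2"]
        of_int_floor_le[of "?w $ 1"] of_int_floor_le[of "?w $ 2"]
      by linarith
    moreover have "6 \<le> real n / real N"
    proof -
      have "real (6 * N) \<le> real n"
        using n by (simp only: of_nat_le_iff)
      then show ?thesis
        using N(1) by (simp add: pos_le_divide_eq)
    qed
    moreover have "q / 2 \<le> x" if "q - 3 \<le> x" "6 \<le> q" for q x :: real
      using that by linarith
    ultimately have le: "real n / real N / 2 \<le> (?w $ 1 + ?w $ 2) - (z $ 1 + z $ 2)"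
      by blast
    have "0 < n"
      using n N(1) by linarith
    then have "1 / (2 * real N) = (real n / real N / 2) / real n"
      by simp
    also have "\<dots> \<le> ((?w $ 1 + ?w $ 2) - (z $ 1 + z $ 2)) / real n"
      by (intro divide_right_mono le) simp
    also have "\<dots> = ((?w - z) /\<^sub>R real n) $ 1 + ((?w - z) /\<^sub>R real n) $ 2"
      by (simp add: divide_inverse algebra_simps)
    finally show ?thesis
      by (simp only: H_def mem_Collect_eq)
  qed
  then have "(\<Union>n\<in>{6 * N..}. {((push c ^^ n) z - z) /\<^sub>R real n | z. True}) \<subseteq> H"
    by auto
  then have "closure (\<Union>n\<in>{6 * N..}. {((push c ^^ n) z - z) /\<^sub>R real n | z. True}) \<subseteq> H"
    using \<open>closed H\<close> by (rule closure_minimal)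
  moreover have "rotation_set (push c) \<subseteq> closure (\<Union>n\<in>{6 * N..}. {((push c ^^ n) z - z) /\<^sub>R real n | z. True})"
    unfolding rotation_set_def using N(1) by (intro INF_lower) auto
  moreover have "0 \<notin> H"
    using N(1) by (simp add: H_def)
  ultimately show ?thesis
    by blast
qed

text \<open>
  Derivatives do not see the translation, so \<open>C\<^sup>k\<close> closeness reduces to closeness of the values.
\<close>
lemma iter_partial_push:
  assumes "is \<noteq> []"
  shows "iter_partial is (push c) = iter_partial is (push 0)"
proof -
  have shift: "push c = (\<lambda>z. push 0 z + vector [c, c])"
    by (auto simp: vec_eq_iff forall_2)
  have shift': "push 0 = (\<lambda>z. push c z + (- vector [c, c]))"
    by (simp add: shift)
  have add_const: "((\<lambda>z. F z + v) has_derivative D) (at z)"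
    if "(F has_derivative D) (at z)" for F :: "real^2 \<Rightarrow> real^2" and v D z
    using has_derivative_add[OF that has_derivative_const] by simp
  have "(push c has_derivative D) (at z) \<longleftrightarrow> (push 0 has_derivative D) (at z)" for D z
    using add_const[of "push 0" D z "vector [c, c]"] add_const[of "push c" D z "- vector [c, c]"]
    unfolding shift[symmetric] shift'[symmetric] by blast
  then have "partial_deriv i (push c) = partial_deriv i (push 0)" for i
    by (auto simp: partial_deriv_def frechet_derivative_def)
  then show ?thesis
    using assms by (cases "is" rule: rev_cases) (auto simp: iter_partial_def)
qed

lemma push_in_Ck_ball:
  assumes "0 < \<epsilon>"
  shows "push (\<epsilon> / 3) \<in> Ck_ball \<infinity> k \<epsilon> (push 0)"
proof -
  have "dist (iter_partial is (push (\<epsilon> / 3)) x) (iter_partial is (push 0) x) < \<epsilon>" for "is" x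
  proof (cases "is = []")
    case True
    have "push (\<epsilon> / 3) x - push 0 x = vector [\<epsilon> / 3, \<epsilon> / 3]"
      by (simp add: vec_eq_iff forall_2)
    then show ?thesis
      using True assms norm_vec2_le[of "vector [\<epsilon> / 3, \<epsilon> / 3]"] by (simp add: iter_partial_def dist_norm)
  next
    case False
    then show ?thesis
      using iter_partial_push[OF False, of "\<epsilon> / 3"] assms by simp
  qed
  then show ?thesis
    by (simp add: Ck_ball_def push_lift_Diff0)
qed

section \<open>High-frequency shears realise pseudo-orbits\<close>

definition wave :: "real \<Rightarrow> nat \<Rightarrow> real \<Rightarrow> real" where
  "wave a M x = a * sin (2 * pi * (real M * x))"

definition vshear :: "real \<Rightarrow> nat \<Rightarrow> real^2 \<Rightarrow> real^2" where
  "vshear a M z = vector [z $ 1, z $ 2 + wave a M (z $ 1)]"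

definition hshear :: "real \<Rightarrow> nat \<Rightarrow> real^2 \<Rightarrow> real^2" where
  "hshear a M z = vector [z $ 1 + wave a M (z $ 2), z $ 2]"

text \<open>
  The order of the shears matters: of an arriving curve only the horizontal extent is under control,
  and it is the vertical shear that turns horizontal extent into a stretched image.
\<close>
definition noisy :: "real \<Rightarrow> nat \<Rightarrow> real^2 \<Rightarrow> real^2" where
  "noisy a M z = hshear a M (vshear a M (push 0 z))"

lemma shear_nth [simp]:
  "vshear a M z $ 1 = z $ 1" "vshear a M z $ 2 = z $ 2 + wave a M (z $ 1)"
  "hshear a M z $ 1 = z $ 1 + wave a M (z $ 2)" "hshear a M z $ 2 = z $ 2"
  by (simp_all add: vshear_def hshear_def)

lemma wave_minus [simp]: "wave (- a) M x = - wave a M x"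
  by (simp add: wave_def)

lemma abs_wave_le: "0 \<le> a \<Longrightarrow> \<bar>wave a M x\<bar> \<le> a"
  by (simp add: wave_def abs_mult mult_left_le)

lemma wave_phase:
  assumes "k \<in> \<int>" "0 < M"
  shows "wave a M ((k + \<theta>) / real M) = a * sin (2 * pi * \<theta>)"
proof -
  obtain j where j: "k = of_int j"
    using assms(1) by (rule Ints_cases)
  have "sin (2 * pi * (k + \<theta>)) = sin (2 * pi * \<theta>)"
    unfolding j distrib_left sin_add by simp
  then show ?thesis
    using assms(2) by (simp add: wave_def)
qed

lemma wave_add_Ints: "m \<in> \<int> \<Longrightarrow> wave a M (x + m) = wave a M x"
proof (cases "M = 0")
  case False
  assume m: "m \<in> \<int>"
  have "wave a M ((real M * m + real M * x) / real M) = a * sin (2 * pi * (real M * x))"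
    using False m by (intro wave_phase Ints_mult) auto
  moreover have "(real M * m + real M * x) / real M = x + m"
    using False by (simp add: field_simps)
  ultimately show ?thesis
    by (simp add: wave_def)
qed (simp add: wave_def)

lemma continuous_shear:
  "continuous_on UNIV (vshear a M)" "continuous_on UNIV (hshear a M)"
proof -
  have "vshear a M = (\<lambda>z. \<chi> i. if i = 1 then z $ 1 else z $ 2 + wave a M (z $ 1))"
    "hshear a M = (\<lambda>z. \<chi> i. if i = 1 then z $ 1 + wave a M (z $ 2) else z $ 2)"
    by (auto simp: vec_eq_iff forall_2)
  moreover have "continuous_on UNIV (\<lambda>z :: real^2. \<chi> i::2. if i = 1 then z $ 1 else z $ 2 + wave a M (z $ 1))"
  proof (rule continuous_on_vec_lambda)
    show "continuous_on UNIV (\<lambda>z :: real^2. if i = 1 then z $ 1 else z $ 2 + wave a M (z $ 1))" for i :: 2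
      by (cases "i = 1") (auto simp: wave_def intro!: continuous_intros)
  qed
  moreover have "continuous_on UNIV (\<lambda>z :: real^2. \<chi> i::2. if i = 1 then z $ 1 + wave a M (z $ 2) else z $ 2)"
  proof (rule continuous_on_vec_lambda)
    show "continuous_on UNIV (\<lambda>z :: real^2. if i = 1 then z $ 1 + wave a M (z $ 2) else z $ 2)" for i :: 2
      by (cases "i = 1") (auto simp: wave_def intro!: continuous_intros)
  qed
  ultimately show "continuous_on UNIV (vshear a M)" "continuous_on UNIV (hshear a M)"
    by simp_all
qed

lemma shear_inverse:
  "vshear (- a) M (vshear a M z) = z" "hshear (- a) M (hshear a M z) = z"
  "vshear a M (vshear (- a) M z) = z" "hshear a M (hshear (- a) M z) = z"
  by (simp_all add: vec_eq_iff forall_2)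

lemma continuous_noisy: "continuous_on UNIV (noisy a M)"
  unfolding noisy_def
  by (intro continuous_on_compose2[OF continuous_shear(2)] continuous_on_compose2[OF continuous_shear(1)]
      continuous_push) auto

lemma noisy_equivariant: "Z2_equivariant (noisy a M)"
  unfolding Z2_equivariant_def
proof (intro allI ballI)
  fix z m assume m: "m \<in> Z2"
  then have "push 0 (z + m) = push 0 z + m"
    using push_equivariant by (simp add: Z2_equivariant_def)
  moreover have "vshear a M (w + m) = vshear a M w + m" "hshear a M (w + m) = hshear a M w + m" for w
    using m by (simp_all add: vec_eq_iff forall_2 Z2_iff wave_add_Ints)
  ultimately show "noisy a M (z + m) = noisy a M z + m"
    by (simp only: noisy_def)
qed

lemma Cr_on_0: "Cr_on 0 X F \<longleftrightarrow> continuous_on X F"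
  by (auto simp: Cr_on_def iter_partial_def zero_enat_def)

lemma noisy_lift_Diff0: "noisy a M \<in> lift_Diff0 0"
proof -
  have cont: "continuous_on UNIV (\<lambda>z. inv (push 0) (vshear (- a) M (hshear (- a) M z)))"
    by (intro continuous_on_compose2[OF continuous_inv_push] continuous_on_compose2[OF continuous_shear(1)]
        continuous_shear(2)) auto
  show ?thesis
  proof (rule lift_Diff0I[OF noisy_equivariant _ _ continuous_noisy _ cont])
    show "Cr_on 0 UNIV (noisy a M)"
      by (simp add: Cr_on_0 continuous_noisy)
    show "Cr_on 0 UNIV (\<lambda>z. inv (push 0) (vshear (- a) M (hshear (- a) M z)))"
      using cont by (simp add: Cr_on_0)
    show "inv (push 0) (vshear (- a) M (hshear (- a) M (noisy a M z))) = z" for z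
      by (simp add: noisy_def shear_inverse bij_is_inj[OF bij_push])
    show "noisy a M (inv (push 0) (vshear (- a) M (hshear (- a) M z))) = z" for z
      by (simp add: noisy_def shear_inverse surj_f_inv_f bij_is_surj[OF bij_push])
  qed
qed

lemma noisy_in_Ck_ball:
  assumes "0 \<le> a" "2 * a < \<epsilon>"
  shows "noisy a M \<in> Ck_ball 0 0 \<epsilon> (push 0)"
proof -
  have "dist (noisy a M z) (push 0 z) < \<epsilon>" for z
  proof -
    have "\<bar>(noisy a M z - push 0 z) $ 1\<bar> \<le> a" "\<bar>(noisy a M z - push 0 z) $ 2\<bar> \<le> a"
      using assms(1) by (simp_all add: noisy_def abs_wave_le del: push_nth)
    then show ?thesis
      using norm_vec2_le[of "noisy a M z - push 0 z"] assms(2) by (simp add: dist_norm del: push_nth)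
  qed
  then show ?thesis
    by (simp add: Ck_ball_def noisy_lift_Diff0 iter_partial_def)
qed

text \<open>
  Take for \<open>r\<close> the first time the value \<open>\<beta>\<close> is attained and for \<open>l\<close> the last time before \<open>r\<close> the value \<open>\<alpha>\<close>
  is attained; in between the intermediate value theorem keeps the function within the bounds.
\<close>
lemma first_crossing:
  fixes \<phi> :: "real \<Rightarrow> real"
  assumes cont: "continuous_on {t1..t2} \<phi>" and le: "t1 \<le> t2" "\<alpha> \<le> \<beta>"
    and ends: "\<phi> t1 \<le> \<alpha>" "\<beta> \<le> \<phi> t2"
  obtains l r where "t1 \<le> l" "l \<le> r" "r \<le> t2" "\<phi> l = \<alpha>" "\<phi> r = \<beta>"
    "\<And>t. t \<in> {l..r} \<Longrightarrow> \<alpha> \<le> \<phi> t \<and> \<phi> t \<le> \<beta>"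
proof -
  have cpt: "compact {t \<in> {u..v}. \<phi> t = y}" if "t1 \<le> u" "v \<le> t2" for u v y
  proof -
    have "continuous_on {u..v} \<phi>"
      using that by (intro continuous_on_subset[OF cont]) auto
    then have "closed {t \<in> {u..v}. \<phi> t = y}"
      by (intro continuous_closed_preimage_constant) auto
    moreover have "bounded {t \<in> {u..v}. \<phi> t = y}"
      by (rule bounded_subset[of "{u..v}"]) auto
    ultimately show ?thesis
      by (simp add: compact_eq_bounded_closed)
  qed
  have ivt: "\<exists>t. u \<le> t \<and> t \<le> v \<and> \<phi> t = y"
    if "t1 \<le> u" "u \<le> v" "v \<le> t2" "\<phi> u \<le> y" "y \<le> \<phi> v" for u v y
    using that by (intro IVT' continuous_on_subset[OF cont]) auto
  have "{t \<in> {t1..t2}. \<phi> t = \<beta>} \<noteq> {}"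
    using ivt[of t1 t2 \<beta>] le ends by auto
  from compact_attains_inf[OF cpt this] obtain r where r: "t1 \<le> r" "r \<le> t2" "\<phi> r = \<beta>"
    and rmin: "\<And>t. t1 \<le> t \<Longrightarrow> t \<le> t2 \<Longrightarrow> \<phi> t = \<beta> \<Longrightarrow> r \<le> t"
    by auto
  have "{t \<in> {t1..r}. \<phi> t = \<alpha>} \<noteq> {}"
    using ivt[of t1 r \<alpha>] le ends r by auto
  from compact_attains_sup[OF cpt this] r obtain l where l: "t1 \<le> l" "l \<le> r" "\<phi> l = \<alpha>"
    and lmax: "\<And>t. t1 \<le> t \<Longrightarrow> t \<le> r \<Longrightarrow> \<phi> t = \<alpha> \<Longrightarrow> t \<le> l"
    by auto
  have "\<alpha> \<le> \<phi> t \<and> \<phi> t \<le> \<beta>" if t: "t \<in> {l..r}" for t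
  proof (intro conjI; rule ccontr)
    assume "\<not> \<alpha> \<le> \<phi> t"
    moreover from this obtain u where u: "t \<le> u" "u \<le> r" "\<phi> u = \<alpha>"
      using ivt[of t r \<alpha>] t l r le by auto
    moreover have "u = t"
      using lmax[OF _ u(2,3)] u(1) t l(1) by auto
    ultimately show False
      by simp
  next
    assume "\<not> \<phi> t \<le> \<beta>"
    moreover from this obtain u where u: "t1 \<le> u" "u \<le> t" "\<phi> u = \<beta>"
      using ivt[of t1 t \<beta>] t l r le ends by auto
    moreover have "u = t"
      using rmin[OF u(1) _ u(3)] u(2) t r(2) by auto
    ultimately show False
      by simp
  qed
  then show ?thesis
    using that l r by blast
qed

lemma subpath:
  fixes \<phi> :: "real \<Rightarrow> real"
  assumes cont: "continuous_on {l..r} \<phi>" and t: "t1 \<in> {l..r}" "t2 \<in> {l..r}"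
    and le: "\<phi> t1 \<le> c - s" "c + s \<le> \<phi> t2" "0 \<le> s"
  obtains l' r' where "l \<le> l'" "l' \<le> r'" "r' \<le> r" "\<bar>\<phi> r' - \<phi> l'\<bar> = 2 * s"
    "\<And>t. t \<in> {l'..r'} \<Longrightarrow> \<bar>\<phi> t - c\<bar> \<le> s"
proof (cases "t1 \<le> t2")
  case True
  have "continuous_on {t1..t2} \<phi>"
    using t by (intro continuous_on_subset[OF cont]) auto
  moreover have "c - s \<le> c + s"
    using le(3) by simp
  ultimately obtain l' r' where
    *: "t1 \<le> l'" "l' \<le> r'" "r' \<le> t2" "\<phi> l' = c - s" "\<phi> r' = c + s"
    "\<And>t. t \<in> {l'..r'} \<Longrightarrow> c - s \<le> \<phi> t \<and> \<phi> t \<le> c + s"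
    using first_crossing[OF _ True _ le(1,2)] by blast
  show ?thesis
  proof (rule that[of l' r'])
    show "\<bar>\<phi> t - c\<bar> \<le> s" if "t \<in> {l'..r'}" for t
      using *(6)[OF that] by (simp add: abs_le_iff)
  qed (use * t le(3) in auto)
next
  case False
  have "continuous_on {t2..t1} (\<lambda>t. - \<phi> t)"
    using t by (intro continuous_intros continuous_on_subset[OF cont]) auto
  then obtain l' r' where
    *: "t2 \<le> l'" "l' \<le> r'" "r' \<le> t1" "- \<phi> l' = - c - s" "- \<phi> r' = - c + s"
    "\<And>t. t \<in> {l'..r'} \<Longrightarrow> - c - s \<le> - \<phi> t \<and> - \<phi> t \<le> - c + s"
    using first_crossing[of t2 t1 "\<lambda>t. - \<phi> t" "- c - s" "- c + s"] False le by auto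
  show ?thesis
  proof (rule that[of l' r'])
    show "\<bar>\<phi> t - c\<bar> \<le> s" if "t \<in> {l'..r'}" for t
      using *(6)[OF that] by (auto simp: abs_le_iff)
  qed (use * t le(3) in auto)
qed

lemma wave_attains:
  fixes \<phi> :: "real \<Rightarrow> real"
  assumes cont: "continuous_on {l..r} \<phi>" and le: "l \<le> r" and M: "0 < M" "1 / real M \<le> \<bar>\<phi> r - \<phi> l\<bar>"
  shows "\<exists>t\<in>{l..r}. wave a M (\<phi> t) = a * sin (2 * pi * \<theta>)"
proof -
  define x where "x = min (\<phi> l) (\<phi> r)"
  define k where "k = \<lceil>real M * x - \<theta>\<rceil>"
  define v where "v = (of_int k + \<theta>) / real M"
  have "real M * x \<le> of_int k + \<theta>" "of_int k + \<theta> \<le> real M * x + 1"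
    unfolding k_def by linarith+
  then have "real M * x / real M \<le> v" "v \<le> (real M * x + 1) / real M"
    unfolding v_def by (intro divide_right_mono, simp_all)+
  then have "x \<le> v" "v \<le> x + 1 / real M"
    using M(1) by (simp_all add: add_divide_distrib)
  then have "\<phi> l \<le> v \<and> v \<le> \<phi> r \<or> \<phi> r \<le> v \<and> v \<le> \<phi> l"
    using M(2) by (auto simp: x_def min_def abs_if split: if_splits)
  then obtain t where "t \<in> {l..r}" "\<phi> t = v"
    using IVT'[of \<phi> l v r] IVT2'[of \<phi> r v l] le cont by (metis atLeastAtMost_iff)
  moreover have "wave a M v = a * sin (2 * pi * \<theta>)"
    unfolding v_def using M(1) by (intro wave_phase) auto
  ultimately show ?thesis
    by blast
qed

text \<open>
  The stretching step for one shear. The coordinate \<open>\<phi>\<close> runs through a full period, so the wave takes the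
  values \<open>a\<close> and \<open>- a\<close> while \<open>\<psi>\<close> itself hardly varies; the sheared coordinate therefore sweeps an interval
  of length almost \<open>2 a\<close>, and a subcurve of it spans exactly \<open>[c - s, c + s]\<close>.
\<close>
lemma wave_stretch:
  fixes \<phi> \<psi> :: "real \<Rightarrow> real"
  assumes cont: "continuous_on {l..r} \<phi>" "continuous_on {l..r} \<psi>" and le: "l \<le> r"
    and M: "0 < M" "1 / real M \<le> \<bar>\<phi> r - \<phi> l\<bar>"
    and \<psi>: "\<And>t. t \<in> {l..r} \<Longrightarrow> \<bar>\<psi> t - d\<bar> \<le> 2 * s" and c: "\<bar>c - d\<bar> \<le> a / 2"
    and a: "6 * s \<le> a" "0 \<le> s"
  obtains l' r' where "l \<le> l'" "l' \<le> r'" "r' \<le> r"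
    "\<bar>(\<psi> r' + wave a M (\<phi> r')) - (\<psi> l' + wave a M (\<phi> l'))\<bar> = 2 * s"
    "\<And>t. t \<in> {l'..r'} \<Longrightarrow> \<bar>(\<psi> t + wave a M (\<phi> t)) - c\<bar> \<le> s"
proof -
  have "continuous_on {l..r} (\<lambda>t. \<psi> t + wave a M (\<phi> t))"
    unfolding wave_def by (intro continuous_intros cont)
  moreover have "sin (2 * pi * (1 / 4)) = 1"
  proof -
    have "2 * pi * (1 / 4) = pi / 2"
      by simp
    then show ?thesis
      by (simp only: sin_pi_half)
  qed
  moreover have "sin (2 * pi * (3 / 4)) = - 1"
  proof -
    have "2 * pi * (3 / 4) = 3 / 2 * pi"
      by simp
    then show ?thesis
      by (simp only: sin_3over2_pi)
  qed
  ultimately obtain t1 t2 where t: "t1 \<in> {l..r}" "t2 \<in> {l..r}"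
      "wave a M (\<phi> t1) = - a" "wave a M (\<phi> t2) = a"
    using wave_attains[OF cont(1) le M, of a "3 / 4"] wave_attains[OF cont(1) le M, of a "1 / 4"]
    by auto
  have "\<psi> t1 + wave a M (\<phi> t1) \<le> c - s" "c + s \<le> \<psi> t2 + wave a M (\<phi> t2)"
    unfolding t(3,4) using \<psi>[OF t(1)] \<psi>[OF t(2)] c a by linarith+
  from subpath[OF \<open>continuous_on {l..r} (\<lambda>t. \<psi> t + wave a M (\<phi> t))\<close> t(1,2) this a(2)]
  show ?thesis
    using that by blast
qed

text \<open>
  The curve \<open>w\<close> stays in the square of half-width \<open>s\<close> about \<open>c\<close>, and its ends lie on the opposite vertical
  sides. The latter is expressed by the distance of the first coordinates, so that the orientation
  of the curve, which the shears may reverse, does not appear.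
\<close>
definition crosses :: "real^2 \<Rightarrow> real \<Rightarrow> (real \<Rightarrow> real^2) \<Rightarrow> real \<Rightarrow> real \<Rightarrow> bool" where
  "crosses c s w l r \<longleftrightarrow> l \<le> r \<and> continuous_on {l..r} w \<and>
     (\<forall>t\<in>{l..r}. \<forall>i. \<bar>w t $ i - c $ i\<bar> \<le> s) \<and> 2 * s \<le> \<bar>w r $ 1 - w l $ 1\<bar>"

text \<open>
  The unsheared map distorts the tiny square little, so the image of the curve still has a horizontal
  extent of at least \<open>s\<close>. The vertical shear turns this into a vertical crossing at the height of the new
  centre, and the horizontal shear turns the vertical crossing into a horizontal one.
\<close>
lemma crosses_noisy:
  assumes w: "crosses c s w l r" and M: "0 < M" "1 / real M \<le> s" and a: "6 * s \<le> a"
    and c': "\<And>i. \<bar>c' $ i - push 0 c $ i\<bar> \<le> a / 2"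
  obtains l' r' where "crosses c' s (\<lambda>t. noisy a M (w t)) l' r'" "l \<le> l'" "r' \<le> r"
proof -
  have s: "0 \<le> s"
    using M by (meson divide_nonneg_nonneg of_nat_0_le_iff order_trans zero_le_one)
  have le: "l \<le> r" and wc: "continuous_on {l..r} w"
    and wb: "\<And>t i. t \<in> {l..r} \<Longrightarrow> \<bar>w t $ i - c $ i\<bar> \<le> s"
    and span: "2 * s \<le> \<bar>w r $ 1 - w l $ 1\<bar>"
    using w by (auto simp: crosses_def)
  define u where "u t = push 0 (w t)" for t
  have uc: "continuous_on {l..r} u"
    unfolding u_def by (rule continuous_on_compose2[OF continuous_push wc]) auto
  then have uci: "continuous_on {l..r} (\<lambda>t. u t $ i)" for i
    by (intro continuous_intros)
  have db: "\<bar>disp (w t $ 1) (w t $ 2) - disp (c $ 1) (c $ 2)\<bar> \<le> s"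
    "\<bar>disp (w t $ 2) (w t $ 1) - disp (c $ 2) (c $ 1)\<bar> \<le> s" if "t \<in> {l..r}" for t
    using disp_lipschitz[of "w t $ 1" "w t $ 2" "c $ 1" "c $ 2"]
      disp_lipschitz[of "w t $ 2" "w t $ 1" "c $ 2" "c $ 1"] wb[OF that, of 1] wb[OF that, of 2] s
    by simp_all
  have ub1: "\<bar>u t $ 1 - push 0 c $ 1\<bar> \<le> 2 * s" if "t \<in> {l..r}" for t
    using db(1)[OF that] wb[OF that, of 1] unfolding u_def push_nth by linarith
  have ub2: "\<bar>u t $ 2 - push 0 c $ 2\<bar> \<le> 2 * s" if "t \<in> {l..r}" for t
    using db(2)[OF that] wb[OF that, of 2] unfolding u_def push_nth by linarith
  have "\<bar>w r $ i - w l $ i\<bar> \<le> 2 * s" for i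
    using wb[of l i] wb[of r i] le by simp
  from this[of 1] this[of 2] have "\<bar>w r $ 1 - w l $ 1\<bar> + \<bar>w r $ 2 - w l $ 2\<bar> \<le> 4 * s"
    by linarith
  then have "\<bar>disp (w r $ 1) (w r $ 2) - disp (w l $ 1) (w l $ 2)\<bar> \<le> s"
    using disp_lipschitz[of "w r $ 1" "w r $ 2" "w l $ 1" "w l $ 2"] s
    by simp
  then have "s \<le> \<bar>u r $ 1 - u l $ 1\<bar>"
    using span unfolding u_def push_nth by linarith
  then have "1 / real M \<le> \<bar>u r $ 1 - u l $ 1\<bar>"
    using M by linarith
  from wave_stretch[OF uci uci le M(1) this ub2 c'[of 2] a s] obtain l1 r1 where
    1: "l \<le> l1" "l1 \<le> r1" "r1 \<le> r"
      "\<bar>(u r1 $ 2 + wave a M (u r1 $ 1)) - (u l1 $ 2 + wave a M (u l1 $ 1))\<bar> = 2 * s"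
      "\<And>t. t \<in> {l1..r1} \<Longrightarrow> \<bar>(u t $ 2 + wave a M (u t $ 1)) - c' $ 2\<bar> \<le> s"
    by blast
  let ?v = "\<lambda>t. u t $ 2 + wave a M (u t $ 1)"
  have sub: "{l1..r1} \<subseteq> {l..r}"
    using 1 by auto
  have vc: "continuous_on {l1..r1} ?v"
    unfolding wave_def by (intro continuous_intros continuous_on_subset[OF uc sub])
  have "1 / real M \<le> \<bar>?v r1 - ?v l1\<bar>"
    using 1(4) M s by linarith
  have ub1': "\<bar>u t $ 1 - push 0 c $ 1\<bar> \<le> 2 * s" if "t \<in> {l1..r1}" for t
    using ub1 sub that by blast
  from wave_stretch[OF vc continuous_on_subset[OF uci sub] 1(2) M(1)
      \<open>1 / real M \<le> \<bar>?v r1 - ?v l1\<bar>\<close> ub1' c'[of 1] a s]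
  obtain l2 r2 where
    2: "l1 \<le> l2" "l2 \<le> r2" "r2 \<le> r1"
      "\<bar>(u r2 $ 1 + wave a M (?v r2)) - (u l2 $ 1 + wave a M (?v l2))\<bar> = 2 * s"
      "\<And>t. t \<in> {l2..r2} \<Longrightarrow> \<bar>(u t $ 1 + wave a M (?v t)) - c' $ 1\<bar> \<le> s"
    by blast
  have nth: "noisy a M (w t) $ 1 = u t $ 1 + wave a M (?v t)" "noisy a M (w t) $ 2 = ?v t" for t
    by (simp_all add: noisy_def u_def del: push_nth)
  have "crosses c' s (\<lambda>t. noisy a M (w t)) l2 r2"
    unfolding crosses_def
  proof (intro conjI ballI allI)
    have "continuous_on {l2..r2} w"
      using 1 2 by (intro continuous_on_subset[OF wc]) auto
    then show "continuous_on {l2..r2} (\<lambda>t. noisy a M (w t))"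
      by (rule continuous_on_compose2[OF continuous_noisy]) auto
    show "\<bar>noisy a M (w t) $ i - c' $ i\<bar> \<le> s" if "t \<in> {l2..r2}" for t i
      using exhaust_2[of i] 2(5)[OF that] 1(5)[of t] that 2 by (auto simp: nth)
    show "2 * s \<le> \<bar>noisy a M (w r2) $ 1 - noisy a M (w l2) $ 1\<bar>"
      using 2(4) by (simp add: nth)
  qed (use 2 in auto)
  then show ?thesis
    using that[of l2 r2] 1 2 by auto
qed

section \<open>Pseudo-orbits in all directions\<close>

text \<open>
  Pseudo-orbits of \<open>push 0\<close> with \<open>n\<close> steps from \<open>p\<close> to \<open>q\<close>, where each step may err by \<open>a\<close> in each
  coordinate. The coordinatewise bound matches the squares of \<open>crosses\<close>.
\<close>
inductive chain :: "real \<Rightarrow> nat \<Rightarrow> real^2 \<Rightarrow> real^2 \<Rightarrow> bool" for a where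
  refl: "chain a 0 p p"
| step: "chain a n p q \<Longrightarrow> (\<And>i. \<bar>q' $ i - push 0 q $ i\<bar> \<le> a) \<Longrightarrow> chain a (Suc n) p q'"

lemma chain_trans:
  assumes "chain a n q r" "chain a m p q"
  shows "chain a (m + n) p r"
  using assms by induction (auto intro: chain.intros)

lemma chain_translate:
  assumes "chain a n p q" "m \<in> Z2"
  shows "chain a n (p + m) (q + m)"
  using assms(1)
proof induction
  case (step n p q q')
  have "push 0 (q + m) = push 0 q + m"
    using push_equivariant assms(2) by (simp add: Z2_equivariant_def)
  then show ?case
    using step by (intro chain.step[OF step.IH]) (simp del: push_nth)
qed (rule chain.refl)

lemma crosses_chain:
  assumes "chain (a / 2) n p q" "crosses p s w l r" "0 < M" "1 / real M \<le> s" "6 * s \<le> a"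
  shows "\<exists>l' r'. l \<le> l' \<and> r' \<le> r \<and> crosses q s (\<lambda>t. (noisy a M ^^ n) (w t)) l' r'"
  using assms(1,2)
proof induction
  case (refl p)
  then show ?case by auto
next
  case (step n p q q')
  then obtain l' r' where lr: "l \<le> l'" "r' \<le> r"
      and w: "crosses q s (\<lambda>t. (noisy a M ^^ n) (w t)) l' r'"
    by blast
  obtain l'' r'' where "crosses q' s (\<lambda>t. noisy a M ((noisy a M ^^ n) (w t))) l'' r''"
      "l' \<le> l''" "r'' \<le> r'"
    using crosses_noisy[OF w assms(3-5) step(2)] by blast
  with lr show ?case
    by (intro exI[of _ l''] exI[of _ r'']) simp
qed

text \<open>
  Starting from a horizontal segment and passing to subcurves at each step, some point of the segment
  follows the whole pseudo-orbit. Only its two ends are recorded.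
\<close>
lemma noisy_shadows_chain:
  assumes ch: "chain (a / 2) n p q" and M: "0 < M" "1 / real M \<le> s" "6 * s \<le> a"
  obtains z where "\<And>i. \<bar>z $ i - p $ i\<bar> \<le> s" "\<And>i. \<bar>(noisy a M ^^ n) z $ i - q $ i\<bar> \<le> s"
proof -
  have s: "0 \<le> s"
    using M by (meson divide_nonneg_nonneg of_nat_0_le_iff order_trans zero_le_one)
  define w where "w t = p + t *\<^sub>R axis 1 1" for t :: real
  have w1: "w t $ 1 = p $ 1 + t" "w t $ 2 = p $ 2" for t
    by (simp_all add: w_def axis_def)
  have "crosses p s w (- s) s"
    unfolding crosses_def
  proof (intro conjI ballI allI)
    show "continuous_on {- s..s} w"
      unfolding w_def by (intro continuous_intros)
    show "\<bar>w t $ i - p $ i\<bar> \<le> s" if "t \<in> {- s..s}" for t i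
      using that s exhaust_2[of i] by (auto simp: w1 abs_le_iff)
  qed (use s in \<open>auto simp: w1\<close>)
  from crosses_chain[OF ch this M] obtain l' r' where
    lr: "- s \<le> l'" "r' \<le> s" "crosses q s (\<lambda>t. (noisy a M ^^ n) (w t)) l' r'"
    by blast
  then have "l' \<in> {l'..r'}"
    by (simp add: crosses_def)
  then have "\<bar>(noisy a M ^^ n) (w l') $ i - q $ i\<bar> \<le> s" for i
    using lr(3) unfolding crosses_def by blast
  moreover have "\<bar>w l' $ i - p $ i\<bar> \<le> s" for i
    using lr \<open>l' \<in> {l'..r'}\<close> exhaust_2[of i] s by (auto simp: w1 abs_le_iff)
  ultimately show ?thesis
    using that by blast
qed

lemma sinsq_squared_less:
  assumes "0 < x" "x < 1" "k \<le> 1 / 200"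
  shows "x + k * (sinsq x)\<^sup>2 < 1"
proof -
  have pos: "0 < sin (pi * x)"
    by (rule sin_pi_gt_0[OF assms(1,2)])
  have "(sinsq x)\<^sup>2 \<le> sinsq x * 1"
    unfolding power2_eq_square by (intro mult_left_mono) auto
  also have "\<dots> \<le> sin (pi * x) * 1"
    unfolding sinsq_def power2_eq_square using pos by simp
  finally have "(sinsq x)\<^sup>2 < 4 - 4 * x"
    using sin_pi_less[OF assms(1,2)] by simp
  moreover have "k * (sinsq x)\<^sup>2 \<le> (1 / 200) * (sinsq x)\<^sup>2"
    using assms(3) by (intro mult_right_mono) auto
  ultimately show ?thesis
    using assms(2) by simp
qed

text \<open>
  The orbit increases below 1, and its limit is a fixed point, hence an integer.
\<close>
lemma invariant_line_converges:
  fixes x0 k :: real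
  assumes x0: "0 < x0" "x0 < 1" and k: "0 < k" "k \<le> 1 / 200"
  defines "x \<equiv> \<lambda>n. ((\<lambda>t. t + k * (sinsq t)\<^sup>2) ^^ n) x0"
  shows "x \<longlonglongrightarrow> 1"
proof -
  have x_Suc: "x (Suc n) = x n + k * (sinsq (x n))\<^sup>2" for n
    by (simp add: x_def)
  have mono: "x n \<le> x (Suc n)" for n
    using k by (simp add: x_Suc)
  have bounds: "x0 \<le> x n \<and> x n < 1" for n
  proof (induction n)
    case (Suc n)
    then have "x (Suc n) < 1"
      using sinsq_squared_less[of "x n" k] k x0 unfolding x_Suc by simp
    moreover have "x0 \<le> x (Suc n)"
      using Suc mono[of n] by (blast intro: order_trans)
    ultimately show ?case by (rule conjI[rotated])
  qed (use x0 in \<open>simp add: x_def\<close>)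
  have "incseq x"
    using mono by (rule incseq_SucI)
  moreover have le1: "\<forall>n. x n \<le> 1"
    using bounds less_imp_le by blast
  ultimately obtain L where L: "x \<longlonglongrightarrow> L" "\<forall>n. x n \<le> L"
    by (rule incseq_convergent)
  have "(\<lambda>n. x n + k * (sinsq (x n))\<^sup>2) \<longlonglongrightarrow> L + k * (sinsq L)\<^sup>2"
    unfolding sinsq_def by (intro tendsto_intros L)
  then have "L = L + k * (sinsq L)\<^sup>2"
    using LIMSEQ_Suc[OF L(1)] unfolding x_Suc by (rule LIMSEQ_unique[rotated])
  then have "L \<in> \<int>"
    using k by (simp add: sinsq_eq_0_iff)
  moreover have "0 < L"
    using spec[OF L(2), of 0] x0 by (simp add: x_def)
  moreover have "L \<le> 1"
    using LIMSEQ_le_const2[OF L(1)] le1 by blast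
  ultimately have "L = 1"
    by (auto elim!: Ints_cases)
  with L(1) show ?thesis
    by simp
qed

text \<open>
  Two jumps suffice to connect \<open>0\<close> to \<open>v\<close>: one away from the fixed point onto the line, and one from a
  late point of the orbit to \<open>v\<close>, where the motion on the line ends.
\<close>
lemma chain_along_invariant_line:
  assumes line: "\<And>t. push 0 (t *\<^sub>R v) = (t + k * (sinsq t)\<^sup>2) *\<^sub>R v"
    and v: "\<And>i. \<bar>v $ i\<bar> \<le> 1" and k: "0 < k" "k \<le> 1 / 200" and a: "0 < a"
  obtains n where "chain a n 0 v"
proof -
  define x0 where "x0 = min a (1 / 2)"
  have x0: "0 < x0" "x0 < 1" "x0 \<le> a"
    using a by (auto simp: x0_def)
  define x where "x = (\<lambda>n. ((\<lambda>t. t + k * (sinsq t)\<^sup>2) ^^ n) x0)"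
  have push_x: "push 0 (x n *\<^sub>R v) = x (Suc n) *\<^sub>R v" for n
    by (simp add: line x_def)
  have orbit: "chain a (Suc n) 0 (x n *\<^sub>R v)" for n
  proof (induction n)
    case 0
    have "\<bar>x 0 * v $ i\<bar> \<le> a" for i
      using mult_mono[OF x0(3) v[of i]] x0 a by (simp add: x_def abs_mult)
    moreover have "push 0 0 = 0"
      using line[of 0] by (simp add: sinsq_def)
    ultimately show ?case
      by (intro chain.step[OF chain.refl]) simp
  next
    case (Suc n)
    then show ?case
      using a by (intro chain.step[OF Suc]) (simp add: push_x del: push_nth)
  qed
  have "x \<longlonglongrightarrow> 1"
    unfolding x_def by (rule invariant_line_converges[OF x0(1,2) k])
  then have "eventually (\<lambda>n. dist (x n) 1 < a) sequentially"
    using a by (rule tendstoD)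
  then obtain N where N: "\<And>n. N \<le> n \<Longrightarrow> \<bar>x n - 1\<bar> < a"
    by (auto simp: eventually_sequentially dist_real_def)
  have "chain a (Suc (Suc N)) 0 v"
  proof (rule chain.step[OF orbit])
    fix i
    have "\<bar>v $ i - push 0 (x N *\<^sub>R v) $ i\<bar> = \<bar>(x (Suc N) - 1) * v $ i\<bar>"
      unfolding push_x by (simp add: algebra_simps abs_minus_commute)
    also have "\<dots> \<le> a * 1"
      unfolding abs_mult using N[of "Suc N"] v[of i] a by (intro mult_mono) auto
    finally show "\<bar>v $ i - push 0 (x N *\<^sub>R v) $ i\<bar> \<le> a"
      by simp
  qed
  then show ?thesis
    by (rule that)
qed

text \<open>
  Waiting at the fixed point makes all pseudo-orbits available at a common length.
\<close>
lemma chain_wait: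
  assumes "0 \<le> a"
  shows "chain a n 0 0"
proof (induction n)
  case (Suc n)
  then show ?case
    using assms push_fixed_iff[of 0] by (intro chain.step[OF Suc]) (simp del: push_nth)
qed (rule chain.refl)

lemma chain_pad:
  assumes "chain a n 0 v" "n \<le> N" "0 \<le> a"
  shows "chain a N 0 v"
  using chain_trans[OF assms(1) chain_wait[OF assms(3), of "N - n"]] assms(2) by simp

lemma chain_repeat:
  assumes "chain a N 0 v" "v \<in> Z2"
  shows "chain a (N * k) 0 (real k *\<^sub>R v)"
proof (induction k)
  case (Suc k)
  have "real k *\<^sub>R v \<in> Z2"
    using assms(2) by (auto simp: Z2_iff)
  from chain_translate[OF assms(1) this] have "chain a N (real k *\<^sub>R v) (real (Suc k) *\<^sub>R v)"
    by (simp add: algebra_simps)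
  from chain_trans[OF this Suc] show ?case
    by (simp add: add.commute)
qed (simp add: chain.refl)

lemma chain_add:
  assumes "chain a m 0 p" "chain a n 0 q" "p \<in> Z2"
  shows "chain a (m + n) 0 (p + q)"
  using chain_trans[OF chain_translate[OF assms(2,3)] _, of m 0] assms(1) by (simp add: add.commute)

text \<open>
  Every integer vector \<open>(p, q)\<close> is a combination of \<open>(-1, 0)\<close>, \<open>(0, -1)\<close> and \<open>(1, 1)\<close> with coefficients
  \<open>c - p\<close>, \<open>c - q\<close> and \<open>c\<close>, where \<open>c\<close> is chosen as the least number that makes all three nonnegative.
  Their sum is then at most \<open>4 (\<bar>p\<bar> + \<bar>q\<bar>)\<close>.
\<close>
lemma chains_in_all_directions:
  assumes a: "0 < a"
  obtains N where "0 < N"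
    "\<And>m p q. 4 * (\<bar>p\<bar> + \<bar>q\<bar>) \<le> int m \<Longrightarrow> chain a (N * m) 0 (vector [of_int p, of_int q])"
proof -
  let ?v1 = "vector [- 1, 0] :: real^2" and ?v2 = "vector [0, - 1] :: real^2"
    and ?v3 = "vector [1, 1] :: real^2"
  have Z2: "?v1 \<in> Z2" "?v2 \<in> Z2" "?v3 \<in> Z2"
    by (simp_all add: Z2_iff)
  have S0: "sinsq 0 = 0"
    by (simp add: sinsq_def)
  obtain n1 where n1: "chain a n1 0 ?v1"
  proof (rule chain_along_invariant_line[where k = "1 / 1000" and v = ?v1, OF _ _ _ _ a])
    show "push 0 (t *\<^sub>R ?v1) = (t + 1 / 1000 * (sinsq t)\<^sup>2) *\<^sub>R ?v1" for t
      by (simp add: vec_eq_iff forall_2 disp_def S0 power2_eq_square)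
    show "\<bar>?v1 $ i\<bar> \<le> 1" for i
      using exhaust_2[of i] by auto
  qed auto
  obtain n2 where n2: "chain a n2 0 ?v2"
  proof (rule chain_along_invariant_line[where k = "1 / 1000" and v = ?v2, OF _ _ _ _ a])
    show "push 0 (t *\<^sub>R ?v2) = (t + 1 / 1000 * (sinsq t)\<^sup>2) *\<^sub>R ?v2" for t
      by (simp add: vec_eq_iff forall_2 disp_def S0 power2_eq_square)
    show "\<bar>?v2 $ i\<bar> \<le> 1" for i
      using exhaust_2[of i] by auto
  qed auto
  obtain n3 where n3: "chain a n3 0 ?v3"
  proof (rule chain_along_invariant_line[where k = "5 / 1000" and v = ?v3, OF _ _ _ _ a])
    show "push 0 (t *\<^sub>R ?v3) = (t + 5 / 1000 * (sinsq t)\<^sup>2) *\<^sub>R ?v3" for t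
      by (simp add: vec_eq_iff forall_2 disp_def S0 power2_eq_square)
    show "\<bar>?v3 $ i\<bar> \<le> 1" for i
      using exhaust_2[of i] by auto
  qed auto
  define N where "N = n1 + n2 + n3 + 1"
  have ch: "chain a N 0 ?v1" "chain a N 0 ?v2" "chain a N 0 ?v3"
    using chain_pad[OF n1] chain_pad[OF n2] chain_pad[OF n3] a by (simp_all add: N_def)
  have "chain a (N * m) 0 (vector [of_int p, of_int q])" if pq: "4 * (\<bar>p\<bar> + \<bar>q\<bar>) \<le> int m" for m p q
  proof -
    define c where "c = max 0 (max p q)"
    define k1 k2 k3 where k: "k1 = nat (c - p)" "k2 = nat (c - q)" "k3 = nat c"
    have ints: "int k1 = c - p" "int k2 = c - q" "int k3 = c"
      by (auto simp: k c_def)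
    have "int (k1 + k2 + k3) \<le> int m"
    proof -
      have "c \<le> \<bar>p\<bar> + \<bar>q\<bar>"
        by (auto simp: c_def)
      then show ?thesis
        using pq unfolding of_nat_add ints distrib_left by linarith
    qed
    then have le: "k1 + k2 + k3 \<le> m"
      by simp
    have Z: "real j *\<^sub>R v \<in> Z2" if "v \<in> Z2" for j v
      using that by (auto simp: Z2_iff)
    have "chain a (N * k1 + N * k2 + N * k3) 0 (real k1 *\<^sub>R ?v1 + real k2 *\<^sub>R ?v2 + real k3 *\<^sub>R ?v3)"
      by (intro chain_add chain_repeat ch Z2 Z Z2_add)
    moreover have "real k1 *\<^sub>R ?v1 + real k2 *\<^sub>R ?v2 + real k3 *\<^sub>R ?v3 = vector [of_int p, of_int q]"
    proof -
      have "real k1 = of_int (c - p)" "real k2 = of_int (c - q)" "real k3 = of_int c"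
        by (metis ints of_int_of_nat_eq)+
      then show ?thesis
        by (simp add: vec_eq_iff forall_2)
    qed
    moreover have "N * k1 + N * k2 + N * k3 \<le> N * m"
      using mult_le_mono2[OF le, of N] by (simp add: distrib_left)
    ultimately show ?thesis
      using chain_pad a by simp
  qed
  then show ?thesis
    using that[of N] by (simp add: N_def)
qed

section \<open>Noise puts zero into the interior of the rotation set\<close>

text \<open>
  A small vector \<open>w\<close> is the limit of average displacements of orbits of lengths \<open>n = N m\<close>: choose a
  pseudo-orbit that displaces \<open>0\<close> by the integer part of \<open>n w\<close>. Rounding costs at most 1 and the
  realisation by an orbit at most \<open>2 s\<close> in each coordinate, which is negligible after division by \<open>n\<close>.
\<close>
lemma rotation_set_noisy:
  assumes a: "0 < a" and s: "6 * s \<le> a" "s \<le> 1" and M: "0 < M" "1 / real M \<le> s"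
  shows "0 \<in> interior (rotation_set (noisy a M))"
proof -
  obtain N where N: "0 < N"
    and ch: "\<And>m p q. 4 * (\<bar>p\<bar> + \<bar>q\<bar>) \<le> int m \<Longrightarrow>
      chain (a / 2) (N * m) 0 (vector [of_int p, of_int q])"
    using chains_in_all_directions[of "a / 2"] a by auto
  let ?g = "noisy a M"
  have "w \<in> closure (\<Union>n\<in>{i..}. {((?g ^^ n) z - z) /\<^sub>R real n | z. True})"
    if w: "norm w < 1 / (16 * real N)" for w i
    unfolding closure_approachable
  proof (intro allI impI)
    fix e :: real assume e: "0 < e"
    obtain m0 :: nat where m0: "6 / e < real m0"
      using reals_Archimedean2 by blast
    \<comment> \<open>For \<open>m \<ge> 16\<close> the rounded target \<open>(p, q)\<close>, with \<open>\<bar>p\<bar>, \<bar>q\<bar> \<le> m / 16 + 1\<close>, is within reach of \<open>N m\<close> steps.\<close>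
    define m where "m = 16 + i + m0"
    define n where "n = N * m"
    have n: "0 < n" "m \<le> n"
      using N by (auto simp: n_def m_def)
    define p where "p j = \<lfloor>real n * w $ j\<rfloor>" for j
    have pb: "\<bar>p j\<bar> \<le> int m div 16 + 1" for j
    proof -
      have "\<bar>real n * w $ j\<bar> \<le> real n * (1 / (16 * real N))"
        unfolding abs_mult using component_le_norm_cart[of w j] w by (intro mult_mono) auto
      also have "\<dots> = real m / 16"
        using N by (simp add: n_def)
      finally have "\<bar>real n * w $ j\<bar> \<le> real m / 16" .
      then show ?thesis
        unfolding p_def by linarith
    qed
    have "4 * (\<bar>p 1\<bar> + \<bar>p 2\<bar>) \<le> int m"
    proof -
      have "\<bar>p 1\<bar> + \<bar>p 2\<bar> \<le> 2 * (int m div 16) + 2"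
        using pb[of 1] pb[of 2] by linarith
      moreover have "16 * (int m div 16) \<le> int m" "16 \<le> int m"
        by (simp_all add: m_def)
      ultimately show ?thesis
        unfolding distrib_left by linarith
    qed
    from ch[OF this] obtain z where z: "\<And>j. \<bar>z $ j - 0 $ j\<bar> \<le> s"
      "\<And>j. \<bar>(?g ^^ n) z $ j - vector [of_int (p 1), of_int (p 2)] $ j\<bar> \<le> s"
      using noisy_shadows_chain[OF _ M s(1)] unfolding n_def by blast
    let ?y = "((?g ^^ n) z - z) /\<^sub>R real n"
    have comp: "\<bar>(?y - w) $ j\<bar> \<le> 3 / real n" for j
    proof -
      have "vector [of_int (p 1), of_int (p 2)] $ j = (of_int (p j) :: real)"
        using exhaust_2[of j] by auto
      then have "\<bar>(?g ^^ n) z $ j - of_int (p j)\<bar> \<le> s" "\<bar>z $ j\<bar> \<le> s"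
        using z(1)[of j] z(2)[of j] by simp_all
      moreover have "of_int (p j) \<le> real n * w $ j" "real n * w $ j < of_int (p j) + 1"
        unfolding p_def by linarith+
      ultimately have "\<bar>(?g ^^ n) z $ j - z $ j - real n * w $ j\<bar> \<le> 3"
        using s(2) by linarith
      then have "\<bar>(?g ^^ n) z $ j - z $ j - real n * w $ j\<bar> / real n \<le> 3 / real n"
        by (rule divide_right_mono) simp
      moreover have "(?y - w) $ j = ((?g ^^ n) z $ j - z $ j - real n * w $ j) / real n"
        using n by (simp add: field_simps)
      ultimately show ?thesis
        by (simp add: abs_divide)
    qed
    have "dist ?y w \<le> 6 / real n"
      using norm_vec2_le[of "?y - w"] comp[of 1] comp[of 2] by (simp add: dist_norm)
    also have "\<dots> < e"
    proof -
      have "6 / e < real n"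
        using m0 n by (simp add: m_def)
      then show ?thesis
        using e n by (simp add: field_simps)
    qed
    finally have "dist ?y w < e" .
    moreover have "i \<le> n"
      using n by (simp add: m_def)
    ultimately show "\<exists>y\<in>\<Union>n\<in>{i..}. {((?g ^^ n) z - z) /\<^sub>R real n |z. True}. dist y w < e"
      by blast
  qed
  then have "ball 0 (1 / (16 * real N)) \<subseteq> rotation_set ?g"
    unfolding rotation_set_def by (auto simp: dist_norm)
  then show ?thesis
    using N by (auto simp: mem_interior intro!: exI[of _ "1 / (16 * real N)"])
qed

theorem theorem3:
  shows "\<exists>f \<in> lift_Diff0 \<infinity>.
    (\<forall>U. openin (Cr_topology \<infinity>) U \<and> f \<in> U \<longrightarrow> (\<exists>f'\<in>U. 0 \<notin> rotation_set f')) \<and>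
    (\<forall>U. openin (Cr_topology 0) U \<and> f \<in> U \<longrightarrow> (\<exists>f'\<in>U. 0 \<in> interior (rotation_set f'))) \<and>
    (\<exists>z. f z = z \<and> (\<forall>w. f w = w \<longrightarrow> (\<exists>m\<in>Z2. w = z + m)))"
proof (rule bexI[of _ "push 0"], intro conjI allI impI)
  fix U assume "openin (Cr_topology \<infinity>) U \<and> push 0 \<in> U"
  then obtain k \<epsilon> where \<epsilon>: "0 < \<epsilon>" "Ck_ball \<infinity> k \<epsilon> (push 0) \<subseteq> U"
    unfolding openin_Cr_topology by blast
  then have "push (\<epsilon> / 3) \<in> U"
    using push_in_Ck_ball by blast
  moreover have "0 \<notin> rotation_set (push (\<epsilon> / 3))"
    using \<epsilon>(1) by (intro rotation_set_push) simp
  ultimately show "\<exists>f'\<in>U. 0 \<notin> rotation_set f'"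
    by blast
next
  fix U assume "openin (Cr_topology 0) U \<and> push 0 \<in> U"
  then obtain k \<epsilon> where k: "enat k \<le> 0" and \<epsilon>: "0 < \<epsilon>" "Ck_ball 0 k \<epsilon> (push 0) \<subseteq> U"
    unfolding openin_Cr_topology by blast
  have "k = 0"
    using k by (simp add: zero_enat_def)
  define a where "a = min 1 (\<epsilon> / 3)"
  have a: "0 < a" "a \<le> 1" "2 * a < \<epsilon>"
    using \<epsilon>(1) by (auto simp: a_def min_def)
  obtain M where M: "M \<noteq> 0" "inverse (real M) < a / 6"
    using real_arch_inverse[of "a / 6"] a(1) by auto
  have "noisy a M \<in> U"
    using noisy_in_Ck_ball[of a \<epsilon> M] a \<epsilon>(2) \<open>k = 0\<close> by auto
  moreover have "0 \<in> interior (rotation_set (noisy a M))"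
    using a M by (intro rotation_set_noisy[of a "a / 6"]) (auto simp: inverse_eq_divide)
  ultimately show "\<exists>f'\<in>U. 0 \<in> interior (rotation_set f')"
    by blast
next
  have "push 0 0 = 0"
    by (simp add: push_fixed_iff)
  moreover have "\<forall>w. push 0 w = w \<longrightarrow> (\<exists>m\<in>Z2. w = 0 + m)"
    by (simp add: push_fixed_iff)
  ultimately show "\<exists>z. push 0 z = z \<and> (\<forall>w. push 0 w = w \<longrightarrow> (\<exists>m\<in>Z2. w = z + m))"
    by blast
qed (rule push_lift_Diff0)

end
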